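(* There exists a non-constant analytic function $f$ on the unit disc $\mathbb{D}$ such that: (1) $f$ belongs to the Smirnov class $\mathcal{N}_+$, i.e. $$\log|f(z)|\le \int_{\mathbb T} \log|f(\zeta)| \,\mathrm{Re} \left(\frac{\zeta+z}{\zeta-z}\right) dm(\zeta)\quad \text{for all } z\in\mathbb D;$$ (2) $\liminf_{t\to\infty} t\, m_f(t) = 0$; and (3) $\mathrm{Re} f = 0$ almost everywhere on $\mathbb{T}$.
   Context: $\mathbb D$ is the open unit disc, $\mathbb T$ the unit circle, and $m$ the normalized Lebesgue measure on $\mathbb T$ ($m(\mathbb T)=1$). For an analytic function $f$ on $\mathbb D$ with non-tangential boundary values a.e. on $\mathbb T$, the same letter $f$ denotes these boundary values, and $m_f(t)=m\{\zeta\in\mathbb T : |f(\zeta)|\ge t\}$ for $t>0$. *)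

theory Defs
  imports "HOL-Analysis.Analysis"
begin

text \<open>The unit circle is parametrised by \<open>\<theta> \<in> [0, 2\<pi>]\<close> via \<open>cis \<theta>\<close>;
  the normalised Lebesgue measure m on the circle corresponds to
  \<open>lebesgue_on {0..2*pi}\<close> divided by \<open>2*pi\<close>.\<close>

definition circle_meas :: "real measure" where
  "circle_meas = lebesgue_on {0..2*pi}"

definition stolz_angle :: "real \<Rightarrow> complex \<Rightarrow> complex set" where
  "stolz_angle \<alpha> \<zeta> = {z. norm z < 1 \<and> norm (z - \<zeta>) < \<alpha> * (1 - norm z)}"

definition nontangential_limit :: "(complex \<Rightarrow> complex) \<Rightarrow> complex \<Rightarrow> complex \<Rightarrow> bool" where
  "nontangential_limit f \<zeta> L \<longleftrightarrow>
     (\<forall>\<alpha>>1. (f \<longlongrightarrow> L) (at \<zeta> within stolz_angle \<alpha> \<zeta>))"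

text \<open>Distribution function \<open>m_f(t) = m{\<zeta> : |f(\<zeta>)| \<ge> t}\<close> of boundary values \<open>g\<close>
  (given as a function of the angle).\<close>
definition distrib_fun :: "(real \<Rightarrow> complex) \<Rightarrow> real \<Rightarrow> real" where
  "distrib_fun g t = measure circle_meas {\<theta>\<in>{0..2*pi}. norm (g \<theta>) \<ge> t} / (2*pi)"

end

theory Submission
  imports Defs "HOL-Complex_Analysis.Complex_Analysis"
begin

text \<open>
  We take \<open>f = \<i> Q \<circ> \<phi>\<close>, where \<open>\<phi>\<close> is the Cayley map of the disc onto the upper half-plane
  and \<open>Q\<close> is entire, real on the real line and zero-free in the upper half-plane. Then \<open>f\<close> is
  continuous up to the circle minus one point and imaginary there. If \<open>|Q| \<le> t\<close> on \<open>[-R, R]\<close>,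
  then \<open>m_f(2t) \<le> 1/R\<close>, because \<open>\<phi>\<close> maps \<open>m\<close> to the Cauchy distribution; so (2) asks for
  arbitrarily large \<open>t\<close> and \<open>R\<close> with \<open>t/R\<close> arbitrarily small. For (1) it suffices that the growth
  of \<open>log |Q|\<close> is dominated by a function that is integrable along \<open>\<phi>\<close>: the Poisson
  formula for \<open>log |f|\<close> on circles of radius \<open>r < 1\<close> then passes to the limit by Fatou's lemma.

  \<open>Q\<close> is a limit of polynomials \<open>Q\<^sub>k\<close> with \<open>Q\<^sub>k\<^sub>+\<^sub>1 = Q\<^sub>k S\<^sup>d\<close>, where \<open>d\<close> bounds the degree of \<open>Q\<^sub>k\<close>
  and \<open>S\<close> is a polynomial approximation with real zeros to \<open>sin(w/N) / (w/N)\<close>. On a real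
  interval that is as long as we please the decay of \<open>S\<^sup>d\<close> cancels the growth of \<open>Q\<^sub>k\<close>, while
  for \<open>N\<close> large \<open>S\<^sup>d\<close> is close to 1 on a given disc. The length \<open>N\<^sup>d\<^sup>+\<^sup>1\<close> of the interval is
  polynomial in \<open>N\<close>, which makes the cost of \<open>S\<^sup>d\<close> in the growth of \<open>log |Q|\<close> summable.
\<close>

section \<open>Polynomial approximations of the cardinal sine\<close>

text \<open>With \<open>u = \<i> w / (n a)\<close> this is \<open>((1 + u)\<^sup>n - (1 - u)\<^sup>n) / (2 n u)\<close>, which tends to
  \<open>sin (w/a) / (w/a)\<close> as \<open>n\<close> grows; the geometric sum avoids the division by zero at \<open>w = 0\<close>.\<close>
definition sinc_poly :: "nat \<Rightarrow> real \<Rightarrow> complex \<Rightarrow> complex" where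
  "sinc_poly n a w =
     (\<Sum>j<n. (1 - \<i> * w / (n * a)) ^ (n - Suc j) * (1 + \<i> * w / (n * a)) ^ j) / n"

lemma sinc_poly_closed_form:
  assumes "n > 0" "a > 0"
  shows "2 * \<i> * w / a * sinc_poly n a w =
           (1 + \<i> * w / (n * a)) ^ n - (1 - \<i> * w / (n * a)) ^ n"
proof -
  have "(1 + \<i> * w / (n * a)) - (1 - \<i> * w / (n * a)) = 2 * \<i> * w / a / n"
    using assms by (simp add: field_simps)
  then show ?thesis
    by (subst power_diff_sumr2) (simp add: sinc_poly_def)
qed

lemma holomorphic_sinc_poly [holomorphic_intros]:
  "sinc_poly n a holomorphic_on S"
proof (cases "n = 0 \<or> a = 0")
  \<comment> \<open>Division by zero yields 0, so the function is constant in
    \<open>w\<close>.\<close>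
  case True
  then show ?thesis by (auto simp: sinc_poly_def[abs_def])
next
  case False
  then show ?thesis
    unfolding sinc_poly_def[abs_def] by (intro holomorphic_intros) auto
qed

text \<open>For real \<open>x\<close> conjugation swaps the factors \<open>1 - u\<close> and
  \<open>1 + u\<close>, and reversing the order of summation swaps them back.\<close>

lemma sinc_poly_real: "sinc_poly n a (of_real x) \<in> \<real>"
proof -
  let ?u = "\<i> * of_real x / (of_nat n * of_real a) :: complex"
  have "cnj (sinc_poly n a (of_real x)) = 
        (\<Sum>j<n. (1 + ?u) ^ (n - Suc j) * (1 - ?u) ^ j) / n"
    by (simp add: sinc_poly_def)
  also have "(\<Sum>j<n. (1 + ?u) ^ (n - Suc j) * (1 - ?u) ^ j) =
             (\<Sum>j<n. (1 - ?u) ^ (n - Suc j) * (1 + ?u) ^ j)"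
    by (subst sum.nat_diff_reindex[symmetric]) (auto intro!: sum.cong simp: mult.commute)
  also have "\<dots> / n = sinc_poly n a (of_real x)"
    by (simp add: sinc_poly_def)
  finally show ?thesis by (simp add: Reals_cnj_iff)
qed

text \<open>By the closed form a zero forces \<open>|1 + u| = |1 - u|\<close>, so \<open>u\<close>
  is imaginary and \<open>w\<close> is real. This keeps products of such factors zero-free in the
  upper half-plane.\<close>

lemma sinc_poly_nonzero:
  assumes "n > 0" "a > 0" "Im w \<noteq> 0"
  shows "sinc_poly n a w \<noteq> 0"
proof
  let ?u = "\<i> * w / (of_nat n * of_real a) :: complex"
  assume "sinc_poly n a w = 0"
  with sinc_poly_closed_form[OF assms(1,2), of w] have "(1 + ?u) ^ n = (1 - ?u) ^ n"
    by simp
  then have "norm (1 + ?u) ^ n = norm (1 - ?u) ^ n" by (metis norm_power)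
  then have "norm (1 + ?u) = norm (1 - ?u)"
    using assms(1) by (simp add: power_eq_iff_eq_base)
  then have "(norm (1 + ?u))\<^sup>2 = (norm (1 - ?u))\<^sup>2" by simp
  then have "Re ?u = 0" unfolding cmod_power2 by (simp add: power2_eq_square algebra_simps)
  moreover have "?u = \<i> * w / of_real (n * a)" by simp
  then have "Re ?u = - Im w / (n * a)" by (simp only: Re_divide_of_real) simp
  ultimately show False using assms by simp
qed

text \<open>Each summand is a product of \<open>n - 1\<close> factors at distance at most
  \<open>q - 1\<close> from 1, and bounds of the form \<open>|x - 1| \<le> b - 1\<close>
  multiply.\<close>

lemma norm_sinc_poly_minus_1_le:
  assumes "n > 0" "a > 0"
  shows "norm (sinc_poly n a w - 1) \<le> (1 + norm w / (n * a)) ^ n - 1"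
proof -
  define u where "u = \<i> * w / (of_nat n * of_real a)"
  define q where "q = 1 + norm w / (n * a)"
  have q: "1 \<le> q" "norm (1 + u - 1) \<le> q - 1" "norm (1 - u - 1) \<le> q - 1"
    using assms by (auto simp: q_def u_def norm_divide norm_mult)
  have mult: "norm (x * y - 1) \<le> b * c - 1"
    if "norm (x - 1) \<le> b - 1" "norm (y - 1) \<le> c - 1" for x y :: complex and b c
  proof -
    have "x * y - 1 = (x - 1) * (y - 1) + (x - 1) + (y - 1)" by (simp add: algebra_simps)
    also have "norm \<dots> \<le> norm (x - 1) * norm (y - 1) + norm (x - 1) + norm (y - 1)"
      by (metis norm_mult norm_triangle_ineq norm_triangle_mono order_refl)
    also have "\<dots> \<le> (b - 1) * (c - 1) + (b - 1) + (c - 1)"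
      using that order_trans[OF norm_ge_zero that(1)] by (intro add_mono mult_mono) auto
    also have "\<dots> = b * c - 1" by (simp add: algebra_simps)
    finally show ?thesis .
  qed
  have pow: "norm (x ^ k - 1) \<le> q ^ k - 1" if "norm (x - 1) \<le> q - 1" for x :: complex and k
  proof (induction k)
    case (Suc k)
    with that show ?case unfolding power_Suc by (intro mult)
  qed simp
  have summand: "norm ((1 - u) ^ (n - Suc j) * (1 + u) ^ j - 1) \<le> q ^ n - 1" if "j < n" for j
  proof -
    have "norm ((1 - u) ^ (n - Suc j) * (1 + u) ^ j - 1) \<le> q ^ (n - Suc j) * q ^ j - 1"
      by (intro mult pow q)
    also have "q ^ (n - Suc j) * q ^ j = q ^ (n - 1)"
      using that by (simp flip: power_add)
    also have "\<dots> \<le> q ^ n" using q by (intro power_increasing) auto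
    finally show ?thesis by simp
  qed
  have "sinc_poly n a w - 1 = (\<Sum>j<n. (1 - u) ^ (n - Suc j) * (1 + u) ^ j - 1) / n"
    using assms by (simp add: sinc_poly_def u_def sum_subtractf diff_divide_distrib)
  also have "norm \<dots> \<le> (\<Sum>j<n. q ^ n - 1) / n"
    using assms by (simp add: norm_divide divide_le_cancel del: sum_constant)
       (intro order_trans[OF norm_sum] sum_mono summand, auto)
  also have "\<dots> = q ^ n - 1" using assms by simp
  finally show ?thesis by (simp add: q_def)
qed

lemma norm_sinc_poly_le:
  assumes "n > 0" "a > 0"
  shows "norm (sinc_poly n a w) \<le> (1 + norm w / (n * a)) ^ n"
  using norm_sinc_poly_minus_1_le[OF assms, of w] norm_triangle_ineq2[of "sinc_poly n a w" 1] by simp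

text \<open>The bound is independent of \<open>n\<close> and tends to 0 as \<open>a\<close> grows
  with \<open>d\<close> and \<open>w\<close> fixed, so \<open>n\<close> may be tied to
  \<open>a\<close> later.\<close>

lemma norm_sinc_poly_power_minus_1_le:
  assumes "n > 0" "a > 0"
  shows "norm (sinc_poly n a w ^ d - 1) \<le> exp (d * (norm w / a)) - 1"
proof -
  let ?q = "(1 + norm w / (n * a)) ^ n"
  have "norm (sinc_poly n a w ^ d - 1) \<le> ?q ^ d - 1"
  proof -
    have "norm ((\<Prod>j<d. 1 + (sinc_poly n a w - 1)) - 1) \<le> (\<Prod>j<d. 1 + norm (sinc_poly n a w - 1)) - 1"
      by (rule norm_prod_minus1_le_prod_minus1)
    also have "\<dots> \<le> (\<Prod>j<d. ?q) - 1"
      using norm_sinc_poly_minus_1_le[OF assms, of w] by (intro diff_right_mono prod_mono) auto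
    finally show ?thesis by simp
  qed
  also have "?q ^ d \<le> (exp (norm w / (n * a)) ^ n) ^ d"
    using assms by (intro power_mono) (auto simp: add.commute)
  also have "exp (norm w / (n * a)) ^ n = exp (norm w / a)"
    using assms by (simp flip: exp_of_nat_mult)
  also have "exp (norm w / a) ^ d = exp (d * (norm w / a))"
    by (simp only: exp_of_nat_mult)
  finally show ?thesis by simp
qed

text \<open>On the real line \<open>|1 + u| = |1 - u| = q\<close>, and the range of \<open>x\<close>
  keeps \<open>q ^ n\<close> below \<open>exp 1\<close>. The geometric sum serves for
  \<open>|x| \<le> a\<close>, the closed form with its gain \<open>a / |x|\<close> beyond; the
  factor 2 merges both bounds.\<close>

lemma norm_sinc_poly_of_real_le:
  assumes "n > 0" "a > 0" "x\<^sup>2 \<le> n * a\<^sup>2"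
  shows "norm (sinc_poly n a (of_real x)) \<le> 2 * exp 1 * a / (a + \<bar>x\<bar>)"
proof -
  define u where "u = \<i> * of_real x / (of_nat n * of_real a :: complex)"
  define q where "q = norm (1 + u)"
  have u: "u = \<i> * of_real (x / (n * a))" by (simp add: u_def)
  have q2: "q\<^sup>2 = 1 + (x / (n * a))\<^sup>2" unfolding q_def u cmod_power2 by simp
  have "norm (1 - u) = q" unfolding q_def u by (simp add: cmod_def)
  note norms = this q_def[symmetric]
  have q1: "q \<ge> 1"
    by (rule power2_le_imp_le) (use q2 in \<open>auto simp: q_def\<close>)
  have "(q ^ n)\<^sup>2 = (1 + (x / (n * a))\<^sup>2) ^ n"
    unfolding q2[symmetric] by (simp flip: power_mult add: mult.commute)
  also have "\<dots> \<le> exp ((x / (n * a))\<^sup>2) ^ n"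
    by (intro power_mono) (auto simp: add.commute)
  also have "\<dots> = exp (x\<^sup>2 / (n * a\<^sup>2))"
    using assms by (simp flip: exp_of_nat_mult add: power2_eq_square field_simps)
  also have "\<dots> \<le> exp 1" using assms by (simp add: divide_le_eq)
  also have "\<dots> \<le> (exp 1)\<^sup>2" by (simp flip: exp_of_nat_mult)
  finally have qn: "q ^ n \<le> exp 1" by (rule power2_le_imp_le) simp
  show ?thesis
  proof (cases "\<bar>x\<bar> \<le> a")
    case True
    have "norm (sinc_poly n a (of_real x)) = norm (\<Sum>j<n. (1 - u) ^ (n - Suc j) * (1 + u) ^ j) / n"
      by (simp add: sinc_poly_def u_def norm_divide)
    also have "\<dots> \<le> (\<Sum>j<n. exp 1) / n"
    proof (intro divide_right_mono order_trans[OF norm_sum] sum_mono)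
      fix j assume "j \<in> {..<n}"
      then have "norm ((1 - u) ^ (n - Suc j) * (1 + u) ^ j) = q ^ (n - 1)"
        by (simp add: norm_mult norm_power norms flip: power_add)
      also have "\<dots> \<le> q ^ n" using q1 by (intro power_increasing) auto
      finally show "norm ((1 - u) ^ (n - Suc j) * (1 + u) ^ j) \<le> exp 1" using qn by simp
    qed auto
    also have "\<dots> = exp 1" using assms by simp
    also have "exp 1 \<le> 2 * exp 1 * a / (a + \<bar>x\<bar>)"
      using assms True by (simp add: field_simps)
    finally show ?thesis .
  next
    case False
    have "2 * \<bar>x\<bar> / a * norm (sinc_poly n a (of_real x)) = norm ((1 + u) ^ n - (1 - u) ^ n)"
      unfolding u_def sinc_poly_closed_form[OF assms(1,2), symmetric]
      using assms by (simp add: norm_mult norm_divide)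
    also have "\<dots> \<le> q ^ n + q ^ n"
      by (intro order_trans[OF norm_triangle_ineq4]) (simp add: norm_power norms)
    also have "\<dots> \<le> 2 * exp 1" using qn by simp
    finally have "norm (sinc_poly n a (of_real x)) \<le> exp 1 * a / \<bar>x\<bar>"
      using assms False by (simp add: field_simps)
    also have "\<dots> \<le> 2 * exp 1 * a / (a + \<bar>x\<bar>)"
      using assms False by (simp add: field_simps)
    finally show ?thesis .
  qed
qed

text \<open>Take logarithms in
  \<open>(1 + x) powr p \<le> 1 + x powr p \<le> exp (x powr p)\<close>. Exponents below 1 matter
  later: such powers of the Cayley map are integrable on the circle.\<close>

lemma ln_1_plus_le_powr:
  fixes x p :: real
  assumes "0 \<le> x" "0 < p" "p \<le> 1"
  shows "ln (1 + x) \<le> x powr p / p"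
proof (cases "x = 0")
  case False
  have "(1 + x) powr p \<le> exp (x powr p)"
  proof -
    have "(1 + x) powr p \<le> 1 + x powr p"
    proof -
      have "(1 + x) powr p = (1 + x) * (1 + x) powr (p - 1)"
        using assms by (simp add: powr_diff)
      also have "\<dots> = (1 + x) powr (p - 1) + x * (1 + x) powr (p - 1)" by (simp add: algebra_simps)
      also have "\<dots> \<le> 1 powr (p - 1) + x * x powr (p - 1)"
        using assms False by (intro add_mono mult_left_mono powr_mono2') auto
      also have "\<dots> = 1 + x powr p"
        using assms False by (simp add: powr_diff)
      finally show ?thesis .
    qed
    also have "\<dots> \<le> exp (x powr p)" by simp
    finally show ?thesis .
  qed
  then have "p * ln (1 + x) \<le> x powr p"
    using assms False by (simp add: powr_def)
  then show ?thesis using assms by (simp add: field_simps)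
qed (use assms in auto)

section \<open>The entire function\<close>

text \<open>The growth bound amounts to \<open>Q\<close> being a polynomial (Liouville), but the
  construction works with \<open>C\<close> and \<open>d\<close> directly. With \<open>d > 0\<close>
  the levels \<open>C * (2 * exp 1 * N) ^ d\<close> tend to infinity.\<close>

definition admissible :: "(complex \<Rightarrow> complex) \<Rightarrow> bool" where
  "admissible Q \<longleftrightarrow> Q holomorphic_on UNIV \<and> (\<forall>x. Q (of_real x) \<in> \<real>) \<and>
     (\<forall>w. Im w > 0 \<longrightarrow> Q w \<noteq> 0) \<and>
     (\<exists>C>0. \<exists>d::nat>0. \<forall>w. norm (Q w) \<le> C * (1 + norm w) ^ d)"

lemma admissible_id: "admissible (\<lambda>w. w)"
proof -
  have "norm w \<le> 1 * (1 + norm w) ^ 1" for w :: complex by simp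
  then show ?thesis unfolding admissible_def
    by (intro conjI allI impI exI[of _ 1] holomorphic_intros) (auto simp: Reals_of_real)
qed

text \<open>The exponent \<open>p\<close> is chosen such that \<open>(N\<^sup>2\<^sup>d N)\<^sup>1\<^sup>-\<^sup>p = sqrt N\<close>.\<close>
lemma norm_sinc_poly_power_le_exp_powr:
  fixes N d :: nat
  assumes "N > 0" "d > 0"
  defines "p \<equiv> 1 - 1 / (4 * real d + 2)"
  shows "norm (sinc_poly (N ^ (2 * d)) N w ^ d) \<le> exp (d / (p * sqrt N) * norm w powr p)"
proof -
  define n where "n = N ^ (2 * d)"
  define M where "M = real n * real N"
  have n: "n > 0" using assms by (simp add: n_def)
  have M: "M > 0" using n assms by (simp add: M_def)
  have p: "0 < p" "p \<le> 1" using assms by (auto simp: p_def field_simps)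
  have "M = real N ^ (2 * d + 1)" by (simp add: M_def n_def)
  then have M_powr: "M = real N powr (2 * d + 1)"
    using assms(1) powr_realpow[of "real N" "2 * d + 1"] by simp
  have "M powr p = M / M powr (1 / (4 * real d + 2))"
    using M by (simp add: p_def powr_diff)
  also have "M powr (1 / (4 * real d + 2)) = real N powr (1 / 2)"
    unfolding M_powr powr_powr by (rule arg_cong[of _ _ "\<lambda>x. real N powr x"]) (simp add: field_simps)
  also have "\<dots> = sqrt N" by (simp add: powr_half_sqrt)
  finally have Mp: "M powr p = M / sqrt N" .
  have "norm (sinc_poly n N w) \<le> (1 + norm w / M) ^ n"
    unfolding M_def using norm_sinc_poly_le[of n "real N" w] n assms by simp
  also have "\<dots> = exp (n * ln (1 + norm w / M))"
    using M by (simp add: exp_of_nat_mult add_pos_nonneg)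
  also have "\<dots> \<le> exp (n * ((norm w / M) powr p / p))"
    unfolding exp_le_cancel_iff using M p by (intro mult_left_mono ln_1_plus_le_powr) auto
  \<comment> \<open>Since \<open>M powr p = M / sqrt N\<close> and \<open>M = n * N\<close>, the
    large factor \<open>n\<close> cancels; the remaining coefficient vanishes as \<open>N\<close>
    grows.\<close>
  also have "n * ((norm w / M) powr p / p) = norm w powr p / (p * sqrt N)"
  proof -
    have "n * ((norm w / M) powr p / p) = norm w powr p / p * (n * sqrt N / M)"
      using M by (simp add: powr_divide Mp mult_ac)
    also have "n * sqrt N / M = 1 / sqrt N"
      using n assms(1) by (simp add: M_def real_div_sqrt field_simps)
    finally show ?thesis by simp
  qed
  finally have "norm (sinc_poly n N w) ^ d \<le> exp (norm w powr p / (p * sqrt N)) ^ d"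
    by (intro power_mono) auto
  then show ?thesis
    by (simp add: norm_power n_def flip: exp_of_nat_mult)
qed

text \<open>The inductive step: \<open>Q' = Q * S ^ d\<close> with
  \<open>S = sinc_poly (N ^ (2 * d)) N\<close> and \<open>N\<close> large. For real \<open>x\<close>
  with \<open>|x| \<le> R = N ^ (d + 1)\<close> the decay of \<open>S ^ d\<close> cancels the growth
  \<open>(N + |x|) ^ d\<close>. This leaves \<open>t\<close> of order \<open>N ^ d\<close>, so
  \<open>t / R\<close> is of order \<open>1 / N\<close>. The arbitrary weight \<open>K\<close> will
  measure the cost of an exponent \<open>p\<close> in a boundary integral.\<close>

lemma admissible_extend:
  fixes K :: "real \<Rightarrow> real" and \<epsilon> \<rho> :: real
  assumes "admissible Q" "\<epsilon> > 0"
  shows "\<exists>Q' c p t R. admissible Q' \<and> 0 < p \<and> p < 1 \<and> 0 \<le> c \<and> c \<le> \<epsilon> \<and> c * K p \<le> \<epsilon> \<and>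
           (\<forall>w. norm (Q' w) \<le> norm (Q w) * exp (c * norm w powr p)) \<and>
           (\<forall>w. norm w \<le> \<rho> \<longrightarrow> norm (Q' w - Q w) \<le> \<epsilon>) \<and>
           1 / \<epsilon> \<le> t \<and> t \<le> \<epsilon> * R \<and> (\<forall>x. \<bar>x\<bar> \<le> R \<longrightarrow> norm (Q' (of_real x)) \<le> t)"
proof -
  from assms(1) obtain C d where Cd: "C > 0" "d > 0" "\<And>w. norm (Q w) \<le> C * (1 + norm w) ^ d"
    unfolding admissible_def by blast
  define p where "p = 1 - 1 / (4 * real d + 2)"
  have p: "0 < p" "p < 1" using Cd by (auto simp: p_def field_simps)
  define c where "c = (\<lambda>N::nat. d / (p * sqrt N))"
  define t where "t = (\<lambda>N::nat. C * (2 * exp 1 * N) ^ d)"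
  have sqrt_top: "filterlim (\<lambda>N::nat. sqrt (real N)) at_top sequentially"
    by (rule filterlim_compose[OF sqrt_at_top filterlim_real_sequentially])
  have c0: "c \<longlonglongrightarrow> 0"
    unfolding c_def
    by (rule real_tendsto_divide_at_top[OF tendsto_const]
          filterlim_tendsto_pos_mult_at_top[OF tendsto_const p(1) sqrt_top])+
  \<comment> \<open>\<open>p\<close> depends on \<open>d\<close> alone, so \<open>K p\<close> stays
    constant while \<open>N\<close> grows.\<close>
  have cK: "(\<lambda>N. c N * K p) \<longlonglongrightarrow> 0"
    using tendsto_mult_left_zero[OF c0] by simp
  have close: "(\<lambda>N::nat. C * (1 + \<bar>\<rho>\<bar>) ^ d * (exp (d * (\<bar>\<rho>\<bar> / N)) - 1)) \<longlonglongrightarrow> C * (1 + \<bar>\<rho>\<bar>) ^ d * (exp (real d * 0) - 1)"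
    by (intro tendsto_intros real_tendsto_divide_at_top[OF tendsto_const filterlim_real_sequentially])
  have t_top: "filterlim t at_top sequentially"
    unfolding t_def using Cd
    by (intro filterlim_tendsto_pos_mult_at_top[OF tendsto_const] filterlim_pow_at_top
          filterlim_real_sequentially) auto
  have tR: "(\<lambda>N::nat. C * (2 * exp 1) ^ d / N) \<longlonglongrightarrow> 0"
    by (rule real_tendsto_divide_at_top[OF tendsto_const filterlim_real_sequentially])
  have "\<forall>\<^sub>F N in sequentially. N > 0 \<and> c N < \<epsilon> \<and> c N * K p < \<epsilon> \<and> 
     C * (1 + \<bar>\<rho>\<bar>) ^ d * (exp (d * (\<bar>\<rho>\<bar> / N)) - 1) < \<epsilon> \<and> 1 / \<epsilon> \<le> t N \<and> C * (2 * exp 1) ^ d / N < \<epsilon>"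
    using order_tendstoD(2)[OF c0 assms(2)] order_tendstoD(2)[OF cK assms(2)]
      order_tendstoD(2)[OF close, of \<epsilon>] assms(2) order_tendstoD(2)[OF tR assms(2)]
      filterlim_at_top[THEN iffD1, OF t_top, rule_format, of "1 / \<epsilon>"] eventually_gt_at_top[of "0::nat"]
    by (intro eventually_conj) simp_all
  then obtain N where N: "N > 0" "c N < \<epsilon>" "c N * K p < \<epsilon>" 
     "C * (1 + \<bar>\<rho>\<bar>) ^ d * (exp (d * (\<bar>\<rho>\<bar> / N)) - 1) < \<epsilon>" "1 / \<epsilon> \<le> t N" "C * (2 * exp 1) ^ d / N < \<epsilon>"
    unfolding eventually_sequentially by blast
  define n where "n = N ^ (2 * d)"
  define S where "S = sinc_poly n N"
  define Q' where "Q' = (\<lambda>w. Q w * S w ^ d)"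
  have n: "n > 0" using N by (simp add: n_def)
  have "norm (Q' w) \<le> C * (1 + norm w) ^ (d + n * d)" for w
  proof -
    have "norm (S w) \<le> (1 + norm w / (real n * real N)) ^ n"
      unfolding S_def using n N by (intro norm_sinc_poly_le) auto
    also have "\<dots> \<le> (1 + norm w) ^ n"
    proof -
      have "norm w / (real n * real N) \<le> norm w / 1"
        using n N(1) mult_mono[of 1 "real n" 1 "real N"] by (intro divide_left_mono) (auto simp: Suc_le_eq)
      then show ?thesis by (intro power_mono) auto
    qed
    finally have "norm (S w) ^ d \<le> ((1 + norm w) ^ n) ^ d" by (intro power_mono) auto
    then have "norm (Q' w) \<le> (C * (1 + norm w) ^ d) * ((1 + norm w) ^ n) ^ d"
      unfolding Q'_def norm_mult norm_power using Cd by (intro mult_mono) auto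
    then show ?thesis by (simp add: power_add power_mult mult.assoc)
  qed
  moreover have "Q' holomorphic_on UNIV"
    using assms(1) unfolding Q'_def S_def admissible_def by (auto intro!: holomorphic_intros)
  moreover have "Q' (of_real x) \<in> \<real>" for x
    using assms(1) unfolding Q'_def S_def admissible_def
    by (auto intro!: Reals_mult Reals_power sinc_poly_real)
  moreover have "Q' w \<noteq> 0" if "Im w > 0" for w
    using assms(1) that n N(1) sinc_poly_nonzero[of n "real N" w]
    unfolding Q'_def S_def admissible_def by auto
  ultimately have "admissible Q'"
    unfolding admissible_def using Cd(1,2) by (intro conjI exI[of _ C] exI[of _ "d + n * d"]) auto
  moreover have "norm (Q' w) \<le> norm (Q w) * exp (c N * norm w powr p)" for w
    unfolding Q'_def S_def norm_mult n_def c_def p_def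
    by (intro mult_left_mono norm_sinc_poly_power_le_exp_powr) (use N Cd in auto)
  moreover have "norm (Q' w - Q w) \<le> \<epsilon>" if "norm w \<le> \<rho>" for w
  proof -
    have "norm (Q' w - Q w) = norm (Q w) * norm (S w ^ d - 1)"
      by (simp add: Q'_def norm_mult[symmetric] algebra_simps)
    also have "\<dots> \<le> (C * (1 + norm w) ^ d) * (exp (d * (norm w / N)) - 1)"
      unfolding S_def using Cd n N(1) by (intro mult_mono norm_sinc_poly_power_minus_1_le) auto
    also have "\<dots> \<le> (C * (1 + \<bar>\<rho>\<bar>) ^ d) * (exp (d * (\<bar>\<rho>\<bar> / N)) - 1)"
      using that Cd N(1) by (intro mult_mono power_mono) (auto intro!: divide_right_mono mult_left_mono)
    finally show ?thesis using N(4) by simp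
  qed
  moreover have "t N \<le> \<epsilon> * real N ^ (d + 1)"
  proof -
    have "t N = C * (2 * exp 1) ^ d / N * real N ^ (d + 1)"
      using N(1) by (simp add: t_def power_mult_distrib)
    also have "\<dots> \<le> \<epsilon> * real N ^ (d + 1)"
      using N by (intro mult_right_mono) auto
    finally show ?thesis .
  qed
  moreover have "norm (Q' (of_real x)) \<le> t N" if "\<bar>x\<bar> \<le> real N ^ (d + 1)" for x
  proof -
    have "x\<^sup>2 \<le> (real N ^ (d + 1))\<^sup>2" using that by (metis abs_ge_zero power2_abs power_mono)
    \<comment> \<open>With \<open>n = N ^ (2 * d)\<close> the range in which the real bound for
      \<open>S\<close> holds ends exactly at \<open>N ^ (d + 1)\<close>.\<close>
    also have "\<dots> = real n * (real N)\<^sup>2"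
      by (simp add: n_def power_mult_distrib flip: power_mult) (simp add: mult.commute)
    finally have S: "norm (S (of_real x)) \<le> 2 * exp 1 * N / (N + \<bar>x\<bar>)"
      unfolding S_def using n N(1) by (intro norm_sinc_poly_of_real_le) auto
    have "norm (Q (of_real x)) \<le> C * (1 + \<bar>x\<bar>) ^ d" using Cd(3)[of "of_real x"] by simp
    also have "\<dots> \<le> C * (N + \<bar>x\<bar>) ^ d"
      using Cd N(1) by (intro mult_left_mono power_mono) auto
    finally have "norm (Q' (of_real x)) \<le> C * (N + \<bar>x\<bar>) ^ d * (2 * exp 1 * N / (N + \<bar>x\<bar>)) ^ d"
      unfolding Q'_def norm_mult norm_power
      using S Cd by (intro mult_mono power_mono) auto
    also have "\<dots> = t N"
      using N(1) by (simp add: t_def power_divide add_nonneg_eq_0_iff)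
    finally show ?thesis .
  qed
  moreover have "0 \<le> c N" using p by (simp add: c_def)
  ultimately show ?thesis
    using p N(2,3,5)
    by (intro exI[of _ Q'] exI[of _ "c N"] exI[of _ p] exI[of _ "t N"] exI[of _ "real N ^ (d + 1)"])
      auto
qed


text \<open>Dependent choice iterates the inductive step with
  \<open>\<epsilon> = (1/2) ^ (k + 2)\<close>, so all corrections from stage \<open>k\<close> on add
  up to at most \<open>(1/2) ^ (k + 1)\<close>. The radius \<open>\<rho> 0 = 3\<close> covers the
  points \<open>\<i>\<close> and \<open>3 * \<i>\<close>, which later show that the limit is not
  constant.\<close>

lemma approximating_sequence_exists:
  fixes K :: "real \<Rightarrow> real"
  obtains Q :: "nat \<Rightarrow> complex \<Rightarrow> complex" and c p t R \<rho> :: "nat \<Rightarrow> real"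
  where "Q 0 = (\<lambda>w. w)" "c 0 = 2" "p 0 = 1 / 2" "\<And>k. admissible (Q k)"
    "\<And>k. 0 < p k \<and> p k < 1 \<and> 0 \<le> c k"
    "\<And>k. c (Suc k) \<le> (1/2) ^ (k + 2)" "\<And>k. c (Suc k) * K (p (Suc k)) \<le> (1/2) ^ (k + 2)"
    "\<And>k w. norm (Q (Suc k) w) \<le> norm (Q k w) * exp (c (Suc k) * norm w powr p (Suc k))"
    "\<And>k w. norm w \<le> \<rho> k \<Longrightarrow> norm (Q (Suc k) w - Q k w) \<le> (1/2) ^ (k + 2)"
    "\<And>k. 2 ^ (k + 2) \<le> t (Suc k)" "\<And>k. t (Suc k) \<le> (1/2) ^ (k + 2) * R (Suc k)"
    "\<And>k x. \<bar>x\<bar> \<le> R (Suc k) \<Longrightarrow> norm (Q (Suc k) (of_real x)) \<le> t (Suc k)"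
    "mono \<rho>" "\<And>k. R (Suc k) \<le> \<rho> (Suc k)" "\<And>k. real k \<le> \<rho> k" "\<rho> 0 = 3"
proof -
  define P :: "nat \<Rightarrow> (complex \<Rightarrow> complex) \<times> real \<times> real \<times> real \<times> real \<times> real \<Rightarrow> bool" where
    "P = (\<lambda>k (Q, c, p, t, R, \<rho>). admissible Q \<and> 0 < p \<and> p < 1 \<and> 0 \<le> c \<and> real k \<le> \<rho> \<and>
           (k = 0 \<longrightarrow> Q = (\<lambda>w. w) \<and> c = 2 \<and> p = 1 / 2 \<and> \<rho> = 3))"
  define Rel :: "nat \<Rightarrow> (complex \<Rightarrow> complex) \<times> real \<times> real \<times> real \<times> real \<times> real \<Rightarrow> _ \<Rightarrow> bool" where
    "Rel = (\<lambda>k (Q, _, _, _, _, \<rho>) (Q', c, p, t, R, \<rho>').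
       c \<le> (1/2) ^ (k + 2) \<and> c * K p \<le> (1/2) ^ (k + 2) \<and>
       (\<forall>w. norm (Q' w) \<le> norm (Q w) * exp (c * norm w powr p)) \<and>
       (\<forall>w. norm w \<le> \<rho> \<longrightarrow> norm (Q' w - Q w) \<le> (1/2) ^ (k + 2)) \<and>
       2 ^ (k + 2) \<le> t \<and> t \<le> (1/2) ^ (k + 2) * R \<and>
       (\<forall>x. \<bar>x\<bar> \<le> R \<longrightarrow> norm (Q' (of_real x)) \<le> t) \<and> \<rho> \<le> \<rho>' \<and> R \<le> \<rho>')"
  have "\<exists>s. \<forall>k. P k (s k) \<and> Rel k (s k) (s (Suc k))"
  proof (rule dependent_nat_choice)
    show "\<exists>x. P 0 x"
      by (intro exI[of _ "(\<lambda>w. w, 2, 1 / 2, 0, 0, 3)"]) (auto simp: P_def admissible_id)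
  next
    fix x k
    assume "P k x"
    obtain Q c p t R \<rho> where x: "x = (Q, c, p, t, R, \<rho>)" by (cases x) auto
    have "admissible Q" using \<open>P k x\<close> by (simp add: P_def x)
    from admissible_extend[OF this, of "(1/2) ^ (k + 2)" K \<rho>]
    obtain Q' c' p' t' R' where Q': "admissible Q'" "0 < p'" "p' < 1" "0 \<le> c'"
       "c' \<le> (1/2) ^ (k + 2)" "c' * K p' \<le> (1/2) ^ (k + 2)"
       "\<forall>w. norm (Q' w) \<le> norm (Q w) * exp (c' * norm w powr p')"
       "\<forall>w. norm w \<le> \<rho> \<longrightarrow> norm (Q' w - Q w) \<le> (1/2) ^ (k + 2)"
       "1 / (1/2) ^ (k + 2) \<le> t'" "t' \<le> (1/2) ^ (k + 2) * R'"
       "\<forall>x. \<bar>x\<bar> \<le> R' \<longrightarrow> norm (Q' (of_real x)) \<le> t'"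
      by auto
    \<comment> \<open>The maximum meets three demands: the radii increase, the disc contains the new
      interval, and the discs exhaust the plane.\<close>
    have "P (Suc k) (Q', c', p', t', R', max \<rho> (max R' (Suc k)))"
      using Q' by (auto simp: P_def)
    moreover have "Rel k x (Q', c', p', t', R', max \<rho> (max R' (Suc k)))"
      unfolding Rel_def x prod.case using Q' by (auto simp: power_divide)
    ultimately show "\<exists>y. P (Suc k) y \<and> Rel k x y" by blast
  qed
  then obtain s where s: "\<And>k. P k (s k)" "\<And>k. Rel k (s k) (s (Suc k))" by blast
  define Q c p t R \<rho> where "Q = fst \<circ> s" and "c = fst \<circ> snd \<circ> s"
    and "p = fst \<circ> snd \<circ> snd \<circ> s" and "t = fst \<circ> snd \<circ> snd \<circ> snd \<circ> s"
    and "R = fst \<circ> snd \<circ> snd \<circ> snd \<circ> snd \<circ> s" and "\<rho> = snd \<circ> snd \<circ> snd \<circ> snd \<circ> snd \<circ> s"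
  note defs = Q_def c_def p_def t_def R_def \<rho>_def
  note s' = s[unfolded P_def Rel_def case_prod_beta]
  show ?thesis
  proof (rule that[of Q c p \<rho> t R])
    show "mono \<rho>" unfolding incseq_Suc_iff using s'(2) by (simp add: defs)
  qed (use s'(1)[of 0] s' in \<open>simp_all add: defs\<close>)
qed

text \<open>\<open>x powr p \<le> 1 + x\<close> for all exponents between 0 and 1, so the terms are
  dominated by a fixed multiple of \<open>c\<close>.\<close>

lemma summable_mult_powr:
  fixes c p :: "nat \<Rightarrow> real"
  assumes "summable c" "\<And>k. 0 \<le> c k" "\<And>k. 0 < p k \<and> p k < 1" "0 \<le> x"
  shows "summable (\<lambda>k. c k * x powr p k)"
proof (rule summable_comparison_test'[OF summable_mult2[OF assms(1), of "1 + x"], of 0])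
  fix k
  have "x powr p k \<le> 1 + x"
  proof (cases "x \<le> 1")
    case True
    then have "x powr p k \<le> 1 powr p k" using assms(3)[of k] assms(4) by (intro powr_mono2) auto
    then show ?thesis using assms(4) by simp
  next
    case False
    then have "x powr p k \<le> x powr 1" using assms(3)[of k] by (intro powr_mono) auto
    then show ?thesis using assms(4) by simp
  qed
  then show "norm (c k * x powr p k) \<le> c k * (1 + x)"
    using assms(2)[of k] by (simp add: abs_mult mult_left_mono)
qed

text \<open>The limit of the approximating sequence. The exponential factors multiply up to the
  growth bound, and each level survives because later corrections on its interval are small.
  Summability of \<open>c k * K (p k)\<close> will make the majorant of \<open>log |Q|\<close>
  integrable on the circle.\<close>

lemma slowly_growing_entire_function_exists:
  fixes K :: "real \<Rightarrow> real"
  assumes K: "\<And>q. 0 \<le> K q"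
  obtains Q :: "complex \<Rightarrow> complex" and c p :: "nat \<Rightarrow> real"
  where "Q holomorphic_on UNIV" "\<And>x. Q (of_real x) \<in> \<real>" "\<And>w. Im w > 0 \<Longrightarrow> Q w \<noteq> 0"
    "\<not> Q constant_on {w. Im w > 0}" 
    "\<And>k. 0 < p k \<and> p k < 1 \<and> 0 \<le> c k" "summable c" "summable (\<lambda>k. c k * K (p k))"
    "\<And>w. norm (Q w) \<le> exp (\<Sum>k. c k * norm w powr p k)"
    "\<And>\<epsilon>. \<epsilon> > 0 \<Longrightarrow> \<exists>t R. 1 / \<epsilon> \<le> t \<and> t \<le> \<epsilon> * R \<and> (\<forall>x. \<bar>x\<bar> \<le> R \<longrightarrow> norm (Q (of_real x)) \<le> t)"
proof -
  obtain F :: "nat \<Rightarrow> complex \<Rightarrow> complex" and c p t R \<rho> :: "nat \<Rightarrow> real"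
  where F0: "F 0 = (\<lambda>w. w)" "c 0 = 2" "p 0 = 1 / 2" and adm: "\<And>k. admissible (F k)"
    and cp: "\<And>k. 0 < p k \<and> p k < 1 \<and> 0 \<le> c k"
    and c_le: "\<And>k. c (Suc k) \<le> (1/2) ^ (k + 2)" and cK_le: "\<And>k. c (Suc k) * K (p (Suc k)) \<le> (1/2) ^ (k + 2)"
    and F_exp: "\<And>k w. norm (F (Suc k) w) \<le> norm (F k w) * exp (c (Suc k) * norm w powr p (Suc k))"
    and F_diff: "\<And>k w. norm w \<le> \<rho> k \<Longrightarrow> norm (F (Suc k) w - F k w) \<le> (1/2) ^ (k + 2)"
    and t: "\<And>k. 2 ^ (k + 2) \<le> t (Suc k)" "\<And>k. t (Suc k) \<le> (1/2) ^ (k + 2) * R (Suc k)"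
    and F_real_le: "\<And>k x. \<bar>x\<bar> \<le> R (Suc k) \<Longrightarrow> norm (F (Suc k) (of_real x)) \<le> t (Suc k)"
    and \<rho>: "mono \<rho>" "\<And>k. R (Suc k) \<le> \<rho> (Suc k)" "\<And>k. real k \<le> \<rho> k" "\<rho> 0 = 3"
    by (rule approximating_sequence_exists[of K]) (rule that, assumption+)
  define Q where "Q w = lim (\<lambda>k. F k w)" for w
  \<comment> \<open>A telescoping geometric sum; the subtracted last term is what carries the
    induction on \<open>j\<close>.\<close>
  have tail: "norm (F (k + j) w - F k w) \<le> (1/2) ^ (k + 1) - (1/2) ^ (k + j + 1)"
    if "norm w \<le> \<rho> k" for w k j
  proof (induction j)
    case (Suc j)
    have "norm w \<le> \<rho> (k + j)" using that monoD[OF \<rho>(1), of k "k + j"] by simp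
    from norm_diff_triangle_le[OF F_diff[OF this] Suc] show ?case by simp
  qed simp
  have tail': "norm (F m w - F k w) \<le> (1/2) ^ (k + 1)" if "norm w \<le> \<rho> k" "k \<le> m" for w k m
  proof -
    from that(2) obtain j where m: "m = k + j" by (auto simp: le_iff_add)
    have "0 \<le> (1/2::real) ^ (k + j + 1)" by (rule zero_le_power) simp
    then show ?thesis using tail[OF that(1), of j] unfolding m by linarith
  qed
  have small: "(\<lambda>k. (1/2::real) ^ (k + 1)) \<longlonglongrightarrow> 0"
    by (intro LIMSEQ_ignore_initial_segment LIMSEQ_realpow_zero) auto
  have lim: "(\<lambda>k. F k w) \<longlonglongrightarrow> Q w" for w
  proof -
    have "Cauchy (\<lambda>k. F k w)"
    proof (rule CauchyI')
      fix e :: real assume "e > 0"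
      then have "\<forall>\<^sub>F k in sequentially. (1/2::real) ^ (k + 1) < e \<and> norm w \<le> real k"
        by (intro eventually_conj order_tendstoD(2)[OF small])
           (auto intro: filterlim_at_top[THEN iffD1, OF filterlim_real_sequentially, rule_format])
      then obtain M where M: "\<And>k. k \<ge> M \<Longrightarrow> (1/2::real) ^ (k + 1) < e \<and> norm w \<le> real k"
        unfolding eventually_sequentially by blast
      have "norm (F m w - F n w) < e" if "M \<le> m" "m < n" for m n
      proof -
        have "norm w \<le> \<rho> m" using M[OF that(1)] \<rho>(3)[of m] by linarith
        from tail'[OF this, of n] M[OF that(1)] that show ?thesis
          by (simp add: norm_minus_commute)
      qed
      then show "\<exists>M. \<forall>m\<ge>M. \<forall>n>m. dist (F m w) (F n w) < e" unfolding dist_norm by blast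
    qed
    then show ?thesis
      unfolding Q_def by (simp add: Cauchy_convergent_iff convergent_LIMSEQ_iff)
  qed
  have close: "norm (Q w - F k w) \<le> (1/2) ^ (k + 1)" if "norm w \<le> \<rho> k" for w k
  proof (rule Lim_bounded)
    show "(\<lambda>m. norm (F m w - F k w)) \<longlonglongrightarrow> norm (Q w - F k w)" by (intro tendsto_intros lim)
    show "\<forall>m\<ge>k. norm (F m w - F k w) \<le> (1/2) ^ (k + 1)" using tail'[OF that] by blast
  qed
  have ulim: "uniform_limit (cball 0 r) F Q sequentially" for r
  proof (rule uniform_limitI)
    fix e :: real assume "e > 0"
    then have "\<forall>\<^sub>F k in sequentially. (1/2::real) ^ (k + 1) < e \<and> r \<le> real k"
      by (intro eventually_conj order_tendstoD(2)[OF small])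
         (auto intro: filterlim_at_top[THEN iffD1, OF filterlim_real_sequentially, rule_format])
    then show "\<forall>\<^sub>F k in sequentially. \<forall>w\<in>cball 0 r. dist (F k w) (Q w) < e"
    proof eventually_elim
      case (elim k)
      show ?case
      proof
        fix w assume "w \<in> cball (0::complex) r"
        then have "norm w \<le> \<rho> k" using elim \<rho>(3)[of k] by simp
        from close[OF this] elim show "dist (F k w) (Q w) < e"
          by (simp add: dist_norm norm_minus_commute)
      qed
    qed
  qed
  have hol: "Q holomorphic_on UNIV"
  proof (rule holomorphic_uniform_sequence)
    show "F n holomorphic_on UNIV" for n using adm[of n] by (simp add: admissible_def)
    show "\<exists>d>0. cball x d \<subseteq> UNIV \<and> uniform_limit (cball x d) F Q sequentially" for x
      by (intro exI[of _ 1] conjI uniform_limit_on_subset[OF ulim[of "norm x + 1"]])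
         (auto simp: dist_norm, metis add.commute norm_minus_commute norm_triangle_sub add_left_mono order_trans)
  qed auto
  \<comment> \<open>On the disc of radius 3 the limit is within 1/2 of the identity, while
    \<open>\<i>\<close> and \<open>3 * \<i>\<close> are 2 apart.\<close>
  have nonconst: "\<not> Q constant_on {w. Im w > 0}"
  proof
    assume "Q constant_on {w. Im w > 0}"
    then have "Q \<i> = Q (3 * \<i>)" unfolding constant_on_def by force
    moreover have "norm (Q \<i> - \<i>) \<le> 1/2" "norm (Q (3 * \<i>) - 3 * \<i>) \<le> 1/2"
      using close[of \<i> 0] close[of "3 * \<i>" 0] by (auto simp: \<rho> F0 norm_mult)
    ultimately have "norm (\<i> - 3 * \<i>) \<le> 1/2 + 1/2"
      by (intro norm_diff_triangle_le[of \<i> "Q \<i>"]) (simp_all add: norm_minus_commute)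
    moreover have "\<i> - 3 * \<i> = -2 * \<i>" by simp
    ultimately show False by (simp add: norm_mult)
  qed
  \<comment> \<open>Hurwitz: a non-constant locally uniform limit of zero-free holomorphic functions
    on a domain is zero-free.\<close>
  have nonzero: "Q w \<noteq> 0" if "Im w > 0" for w
  proof (rule Hurwitz_no_zeros[of "{w. Im w > 0}" F Q])
    show "open {w. 0 < Im w}" by (rule open_halfspace_Im_gt)
    show "connected {w. 0 < Im w}" by (intro convex_connected convex_halfspace_Im_gt)
    show "F n holomorphic_on {w. 0 < Im w}" for n
      using adm[of n] by (auto simp: admissible_def intro: holomorphic_on_subset)
    show "Q holomorphic_on {w. 0 < Im w}" using hol by (rule holomorphic_on_subset) auto
    show "uniform_limit C F Q sequentially" if C: "compact C" for C
    proof -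
      obtain r where "C \<subseteq> cball 0 r"
        using bounded_subset_ballD[OF compact_imp_bounded[OF C], of 0] ball_subset_cball by blast
      then show ?thesis by (rule uniform_limit_on_subset[OF ulim])
    qed
    show "F n z \<noteq> 0" if "z \<in> {w. 0 < Im w}" for n z
      using adm[of n] that by (auto simp: admissible_def)
  qed (use nonconst that in auto)
  have geo: "summable (\<lambda>k. (1/2::real) ^ (k + 2))"
    by (intro summable_ignore_initial_segment summable_geometric) auto
  have sum_c: "summable c"
    by (subst summable_Suc_iff[symmetric], rule summable_comparison_test'[OF geo])
       (use c_le cp in auto)
  have sum_cK: "summable (\<lambda>k. c k * K (p k))"
    by (subst summable_Suc_iff[symmetric], rule summable_comparison_test'[OF geo])
       (use cK_le cp K in \<open>auto simp: abs_mult\<close>)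
  have bound: "norm (Q w) \<le> exp (\<Sum>k. c k * norm w powr p k)" for w
  proof -
    have "norm (F k w) \<le> exp (\<Sum>j\<le>k. c j * norm w powr p j)" for k
    proof (induction k)
      case 0
      \<comment> \<open>\<open>|w| \<le> 1 + |w| \<le> exp (2 * sqrt |w|)\<close> explains the
        starting values \<open>c 0 = 2\<close> and \<open>p 0 = 1 / 2\<close>.\<close>
      have "norm w \<le> exp (ln (1 + norm w))" by (simp add: add_pos_nonneg)
      also have "\<dots> \<le> exp (norm w powr (1 / 2) / (1 / 2))"
        unfolding exp_le_cancel_iff by (intro ln_1_plus_le_powr) auto
      finally show ?case by (simp add: F0 mult.commute)
    next
      case (Suc k)
      have "norm (F (Suc k) w) \<le> norm (F k w) * exp (c (Suc k) * norm w powr p (Suc k))" by (rule F_exp)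
      also have "\<dots> \<le> exp (\<Sum>j\<le>k. c j * norm w powr p j) * exp (c (Suc k) * norm w powr p (Suc k))"
        by (intro mult_right_mono Suc) auto
      finally show ?case by (simp add: exp_add)
    qed
    moreover have "summable (\<lambda>k. c k * norm w powr p k)"
      using sum_c cp by (intro summable_mult_powr) auto
    then have "(\<Sum>j\<le>k. c j * norm w powr p j) \<le> (\<Sum>k. c k * norm w powr p k)" for k
      by (rule sum_le_suminf) (use cp in auto)
    ultimately have "norm (F k w) \<le> exp (\<Sum>k. c k * norm w powr p k)" for k
      by (meson exp_le_cancel_iff order_trans)
    then show ?thesis by (intro Lim_bounded[OF tendsto_norm[OF lim]]) auto
  qed
  have real: "Q (of_real x) \<in> \<real>" for x
    by (rule Lim_in_closed_set[OF closed_complex_Reals _ _ lim]) (use adm in \<open>auto simp: admissible_def\<close>)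
  have levels: "\<exists>t R. 1 / \<epsilon> \<le> t \<and> t \<le> \<epsilon> * R \<and> (\<forall>x. \<bar>x\<bar> \<le> R \<longrightarrow> norm (Q (of_real x)) \<le> t)"
    if \<epsilon>: "\<epsilon> > 0" for \<epsilon>
  proof -
    obtain k where k: "(1/2::real) ^ k < \<epsilon>" using \<epsilon> real_arch_pow_inv[of \<epsilon> "1/2"] by auto
    have "(1/2::real) ^ (k + 1) \<le> (1/2) ^ k" by simp
    with k have k': "(1/2) ^ (k + 1) \<le> \<epsilon>" by linarith
    have "1 / \<epsilon> \<le> 2 ^ k" using k \<epsilon> by (simp add: field_simps power_divide)
    also have "\<dots> \<le> 2 ^ (k + 2)" by (intro power_increasing) auto
    finally have t1: "1 / \<epsilon> \<le> t (Suc k)" using t(1)[of k] by linarith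
    have t_ge: "1 \<le> t (Suc k)" using t(1)[of k] one_le_power[of "2::real" "k + 2"] by linarith
    \<comment> \<open>Raising the level by 1 absorbs the distance from \<open>F (Suc k)\<close> to
      \<open>Q\<close> on the interval; the doubling uses up one factor 1/2.\<close>
    have "t (Suc k) + 1 \<le> 2 * t (Suc k)" using t_ge by simp
    also have "\<dots> \<le> (1/2) ^ (k + 1) * R (Suc k)" using t(2)[of k] by simp
    also have "\<dots> \<le> \<epsilon> * R (Suc k)"
    proof (rule mult_right_mono)
      have "0 < (1/2) ^ (k + 2) * R (Suc k)" using t(2)[of k] t_ge by linarith
      then show "0 \<le> R (Suc k)" by (simp add: zero_less_mult_iff)
    qed (use k' in auto)
    finally have t2: "t (Suc k) + 1 \<le> \<epsilon> * R (Suc k)" .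
    have "norm (Q (of_real x)) \<le> t (Suc k) + 1" if x: "\<bar>x\<bar> \<le> R (Suc k)" for x
    proof -
      have "norm (Q (of_real x)) \<le> norm (F (Suc k) (of_real x)) + norm (Q (of_real x) - F (Suc k) (of_real x))"
        by (rule norm_triangle_sub)
      also have "norm (Q (of_real x) - F (Suc k) (of_real x)) \<le> (1/2) ^ (Suc k + 1)"
        using x \<rho>(2)[of k] by (intro close) auto
      also have "\<dots> \<le> 1" by (rule power_le_one) auto
      finally show ?thesis using F_real_le[OF x] by simp
    qed
    with t1 t2 show ?thesis by (intro exI[of _ "t (Suc k) + 1"] exI[of _ "R (Suc k)"]) auto
  qed
  show ?thesis
    by (rule that[OF hol real nonzero nonconst cp sum_c sum_cK bound levels])
qed

section \<open>A criterion for the Smirnov class\<close>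

text \<open>Fatou's lemma for Bochner integrals: convergence of the integrals supplies the finite
  bound that makes \<open>w\<close> integrable.\<close>

lemma Fatou_real:
  fixes v :: "nat \<Rightarrow> 'a \<Rightarrow> real" and w :: "'a \<Rightarrow> real"
  assumes v: "\<And>n. integrable M (v n)" and nonneg: "\<And>n. AE x in M. 0 \<le> v n x"
    and w: "w \<in> borel_measurable M" and lim: "AE x in M. (\<lambda>n. v n x) \<longlonglongrightarrow> w x"
    and L: "(\<lambda>n. integral\<^sup>L M (v n)) \<longlonglongrightarrow> L"
  shows "integrable M w" and "integral\<^sup>L M w \<le> L"
proof -
  have w0: "AE x in M. 0 \<le> w x"
  proof -
    have "AE x in M. \<forall>n. 0 \<le> v n x" using nonneg by (simp add: AE_all_countable)
    with lim show ?thesis by eventually_elim (auto intro: LIMSEQ_le_const)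
  qed
  have L0: "L \<ge> 0"
    using L by (rule LIMSEQ_le_const) (auto intro!: integral_nonneg_AE nonneg)
  have "(\<integral>\<^sup>+ x. ennreal (w x) \<partial>M) = (\<integral>\<^sup>+ x. liminf (\<lambda>n. ennreal (v n x)) \<partial>M)"
  proof (rule nn_integral_cong_AE)
    show "AE x in M. ennreal (w x) = liminf (\<lambda>n. ennreal (v n x))"
      using lim
    proof eventually_elim
      case (elim x)
      then have "(\<lambda>n. ennreal (v n x)) \<longlonglongrightarrow> ennreal (w x)" by (rule tendsto_ennrealI)
      then show ?case by (simp add: lim_imp_Liminf)
    qed
  qed
  also have "\<dots> \<le> liminf (\<lambda>n. \<integral>\<^sup>+ x. ennreal (v n x) \<partial>M)"
    using v by (intro nn_integral_liminf) auto
  also have "\<dots> = liminf (\<lambda>n. ennreal (integral\<^sup>L M (v n)))"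
    using v nonneg by (simp add: nn_integral_eq_integral)
  also have "\<dots> = ennreal L"
    using tendsto_ennrealI[OF L] by (simp add: lim_imp_Liminf)
  finally have le: "(\<integral>\<^sup>+ x. ennreal (w x) \<partial>M) \<le> ennreal L" .
  then show *: "integrable M w"
    using w w0 by (intro integrableI_nonneg) (auto simp: le_less_trans)
  have "ennreal (integral\<^sup>L M w) \<le> ennreal L"
    using le nn_integral_eq_integral[OF * w0] by simp
  then show "integral\<^sup>L M w \<le> L" using L0 by simp
qed

section \<open>The Poisson formula on the unit circle\<close>

lemma Poisson_kernel_eq:
  "Re ((cis t + z) / (cis t - z)) = (1 - (norm z)\<^sup>2) / (norm (cis t - z))\<^sup>2"
proof -
  have "(cis t + z) / (cis t - z) = (cis t + z) * cnj (cis t - z) / of_real ((norm (cis t - z))\<^sup>2)"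
    using complex_div_cnj[of "cis t + z" "cis t - z"] by (simp only: of_real_power)
  also have "Re \<dots> = Re ((cis t + z) * cnj (cis t - z)) / (norm (cis t - z))\<^sup>2"
    by (rule Re_divide_of_real)
  also have "Re ((cis t + z) * cnj (cis t - z)) = (norm (cis t))\<^sup>2 - (norm z)\<^sup>2"
    unfolding cmod_power2 by (simp add: power2_eq_square algebra_simps)
  finally show ?thesis by simp
qed

text \<open>On the circle \<open>cnj \<zeta> = 1 / \<zeta>\<close>. Up to the factor
  \<open>\<i>\<close>, \<open>cis t / (cis t - z)\<close> is the Cauchy kernel along the circle, and
  the other factor is holomorphic in \<open>\<zeta> = cis t\<close> on the closed disc.\<close>

lemma Poisson_kernel_complex_eq:
  assumes "norm z < 1"
  shows "of_real (Re ((cis t + z) / (cis t - z))) =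
           (1 - (norm z)\<^sup>2) / (1 - cnj z * cis t) * cis t / (cis t - z)"
proof -
  have nz: "cis t \<noteq> z" using assms by (metis less_irrefl norm_cis)
  have "1 - cnj z * cis t = cis t * cnj (cis t - z)"
    by (simp add: algebra_simps cis_mult cis_cnj)
  then have "(1 - (norm z)\<^sup>2) / (1 - cnj z * cis t) * cis t / (cis t - z)
      = (1 - (norm z)\<^sup>2) / (cnj (cis t - z) * (cis t - z))"
    by simp
  also have "cnj (cis t - z) * (cis t - z) = of_real ((norm (cis t - z))\<^sup>2)"
    by (simp only: complex_norm_square mult.commute)
  finally show ?thesis
    unfolding Poisson_kernel_eq by simp
qed

lemma integrable_circle_meas_continuous:
  fixes u :: "real \<Rightarrow> 'a::euclidean_space"
  assumes "continuous_on {0..2*pi} u"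
  shows "integrable circle_meas u"
  unfolding circle_meas_def using continuous_imp_integrable_real[OF assms] .

lemma integral_circle_meas_eq:
  fixes u :: "real \<Rightarrow> 'a::euclidean_space"
  assumes "integrable circle_meas u"
  shows "integral\<^sup>L circle_meas u = integral {0..2*pi} u"
  using assms unfolding circle_meas_def by (intro lebesgue_integral_eq_integral) auto

lemma continuous_on_Poisson_kernel:
  assumes "norm z < 1"
  shows "continuous_on S (\<lambda>t. Re ((cis t + z) / (cis t - z)))"
proof -
  have "cis t \<noteq> z" for t using assms by (metis less_irrefl norm_cis)
  then show ?thesis by (intro continuous_intros) auto
qed

text \<open>Cauchy's formula for \<open>H\<close>, the product of \<open>h\<close> with the
  holomorphic factor of the kernel; that factor is 1 at \<open>z\<close>.\<close>

lemma Poisson_formula: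
  assumes hol: "h holomorphic_on cball 0 1" and z: "norm z < 1"
  shows "(\<integral>t. Re (h (cis t)) * Re ((cis t + z) / (cis t - z)) \<partial>circle_meas) = 2 * pi * Re (h z)"
proof -
  define P where "P t = Re ((cis t + z) / (cis t - z))" for t
  define H where "H \<zeta> = h \<zeta> * ((1 - (norm z)\<^sup>2) / (1 - cnj z * \<zeta>))" for \<zeta>
  have nz: "1 - cnj z * \<zeta> \<noteq> 0" if "norm \<zeta> \<le> 1" for \<zeta>
  proof
    assume "1 - cnj z * \<zeta> = 0"
    then have "norm (cnj z * \<zeta>) = 1" by (metis eq_iff_diff_eq_0 norm_one)
    moreover have "norm z * norm \<zeta> \<le> norm z * 1" using that by (intro mult_left_mono) auto
    ultimately show False using z by (simp add: norm_mult)
  qed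
  have Hz: "H z = h z"
  proof -
    have "1 - cnj z * z = 1 - (norm z)\<^sup>2"
      using complex_norm_square[of z] by (simp add: mult.commute)
    then show ?thesis using nz[of z] z by (simp add: H_def)
  qed
  have "H holomorphic_on cball 0 1"
    unfolding H_def using nz by (intro holomorphic_intros hol) auto
  from Cauchy_integral_circlepath_simple[OF this, of z] z
  have "((\<lambda>u. H u / (u - z)) has_contour_integral 2 * of_real pi * \<i> * h z) (circlepath 0 1)"
    by (simp add: Hz)
  then have "2 * of_real pi * \<i> * h z = contour_integral (circlepath 0 1) (\<lambda>u. H u / (u - z))"
    by (simp add: contour_integral_unique)
  also have "\<dots> = integral {0..2*pi} (\<lambda>t. H (cis t) / (cis t - z) * \<i> * cis t)"
    unfolding circlepath_def by (subst contour_integral_part_circlepath_eq) auto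
  also have "\<dots> = integral {0..2*pi} (\<lambda>t. \<i> * (h (cis t) * of_real (P t)))"
    unfolding P_def Poisson_kernel_complex_eq[OF z] by (simp add: H_def mult_ac)
  also have "\<dots> = \<i> * integral {0..2*pi} (\<lambda>t. h (cis t) * of_real (P t))"
    by (rule integral_mult_right)
  finally have eq: "integral {0..2*pi} (\<lambda>t. h (cis t) * of_real (P t)) = 2 * of_real pi * h z"
    by (simp add: mult.assoc)
  have "continuous_on {0..2*pi} (\<lambda>t. h (cis t) * of_real (P t))"
    unfolding P_def
    by (intro continuous_intros continuous_on_Poisson_kernel z
        continuous_on_compose2[OF holomorphic_on_imp_continuous_on[OF hol]]) auto
  then have int: "integrable circle_meas (\<lambda>t. h (cis t) * of_real (P t))"
    by (rule integrable_circle_meas_continuous)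
  have "(\<integral>t. Re (h (cis t)) * P t \<partial>circle_meas) = (\<integral>t. Re (h (cis t) * of_real (P t)) \<partial>circle_meas)"
    by simp
  also have "\<dots> = Re (\<integral>t. h (cis t) * of_real (P t) \<partial>circle_meas)"
    by (rule integral_Re[OF int])
  also have "\<dots> = 2 * pi * Re (h z)"
    unfolding integral_circle_meas_eq[OF int] eq by simp
  finally show ?thesis by (simp add: P_def)
qed

text \<open>\<open>|r \<zeta> - \<zeta>| = 1 - r\<close>, so a radius runs inside the Stolz angle of
  aperture 2.\<close>

lemma nontangential_limit_radial:
  assumes "nontangential_limit f (cis t) L" "\<And>n. 0 \<le> r n" "\<And>n. r n < 1" "r \<longlonglongrightarrow> 1"
  shows "(\<lambda>n. f (of_real (r n) * cis t)) \<longlonglongrightarrow> L"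
proof -
  have *: "(f \<longlongrightarrow> L) (at (cis t) within stolz_angle 2 (cis t))"
    using assms(1) unfolding nontangential_limit_def by simp
  have "norm (of_real (r n) * cis t - cis t) = 1 - r n" for n
  proof -
    have "of_real (r n) * cis t - cis t = of_real (r n - 1) * cis t" by (simp add: algebra_simps)
    also have "norm \<dots> = 1 - r n" using assms(3)[of n] by (simp only: norm_mult norm_cis norm_of_real) simp
    finally show ?thesis .
  qed
  then have "of_real (r n) * cis t \<in> stolz_angle 2 (cis t)" and "of_real (r n) * cis t \<noteq> cis t" for n
    using assms(2,3)[of n] by (auto simp: stolz_angle_def norm_mult)
  moreover have "(\<lambda>n. of_real (r n) * cis t) \<longlonglongrightarrow> of_real 1 * cis t"
    by (intro tendsto_intros assms)
  ultimately have "filterlim (\<lambda>n. of_real (r n) * cis t) (at (cis t) within stolz_angle 2 (cis t)) sequentially"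
    by (auto simp: filterlim_at)
  with * show ?thesis by (rule filterlim_compose)
qed

text \<open>Write \<open>f = exp h\<close>. The Poisson formula on circles of radius
  \<open>r n\<close> and Fatou's lemma for the non-negative functions \<open>(D - Re h) * P\<close>
  bound the integral of \<open>(D - ln |g|) * P\<close> from above; cancelling the integral of
  \<open>D * P\<close> leaves the claim.\<close>

lemma Smirnov_if_dominated:
  assumes hol: "f holomorphic_on ball 0 1" and nz: "\<And>z. z \<in> ball 0 1 \<Longrightarrow> f z \<noteq> 0"
    and g: "g \<in> borel_measurable circle_meas"
    and lim: "AE t in circle_meas. nontangential_limit f (cis t) (g t)"
    and g_nz: "AE t in circle_meas. g t \<noteq> 0"
    and D: "integrable circle_meas D"
    and dom: "AE t in circle_meas. \<forall>r. 0 \<le> r \<and> r < 1 \<longrightarrow> ln (norm (f (of_real r * cis t))) \<le> D t"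
  shows "integrable circle_meas (\<lambda>t. ln (norm (g t)))"
    and "z \<in> ball 0 1 \<Longrightarrow> ln (norm (f z)) \<le> (1 / (2*pi)) *
         (\<integral>t. ln (norm (g t)) * Re ((cis t + z) / (cis t - z)) \<partial>circle_meas)"
proof -
  obtain h where h: "h holomorphic_on ball 0 1" "\<And>z. z \<in> ball 0 1 \<Longrightarrow> f z = exp (h z)"
    using contractible_imp_holomorphic_log[OF hol convex_imp_contractible nz] by auto
  have ln_f: "ln (norm (f z)) = Re (h z)" if "norm z < 1" for z
    using h(2)[of z] that by simp
  define r where "r n = 1 - 1 / (real n + 2)" for n
  have r: "0 \<le> r n" "r n < 1" for n by (auto simp: r_def field_simps)
  have "(\<lambda>n. 1 / (real n + 2)) \<longlonglongrightarrow> 0"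
    using LIMSEQ_ignore_initial_segment[OF lim_1_over_n, of 2] by (simp add: add.commute)
  from tendsto_diff[OF tendsto_const[of 1] this] have r_lim: "r \<longlonglongrightarrow> 1"
    by (simp add: r_def[abs_def])
  have r_norm: "norm (of_real (r n) * z) < 1" if "norm z \<le> 1" for z :: complex and n
    using mult_left_le[OF that, of "r n"] r[of n] by (simp add: norm_mult)
  \<comment> \<open>The dilated functions are holomorphic up to the circle, as the Poisson formula
    demands.\<close>
  have hr: "(\<lambda>z. h (of_real (r n) * z)) holomorphic_on cball 0 1" for n
    using r_norm
    by (intro holomorphic_on_compose_gen[of "\<lambda>z. of_real (r n) * z" _ h, unfolded o_def, OF _ h(1)]
          holomorphic_intros) auto
  have u_lim: "AE t in circle_meas. (\<lambda>n. Re (h (of_real (r n) * cis t))) \<longlonglongrightarrow> ln (norm (g t))"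
    using lim g_nz
  proof eventually_elim
    case (elim t)
    have "(\<lambda>n. ln (norm (f (of_real (r n) * cis t)))) \<longlonglongrightarrow> ln (norm (g t))"
      using elim by (intro tendsto_intros nontangential_limit_radial r r_lim) auto
    then show ?case by (simp add: ln_f r_norm)
  qed
  have main: "integrable circle_meas (\<lambda>t. (D t - ln (norm (g t))) * Re ((cis t + z) / (cis t - z)))
      \<and> integrable circle_meas (\<lambda>t. D t * Re ((cis t + z) / (cis t - z)))
      \<and> (\<integral>t. (D t - ln (norm (g t))) * Re ((cis t + z) / (cis t - z)) \<partial>circle_meas)
         \<le> (\<integral>t. D t * Re ((cis t + z) / (cis t - z)) \<partial>circle_meas) - 2 * pi * ln (norm (f z))"
    if z: "norm z < 1" for z
  proof -
    define P where "P t = Re ((cis t + z) / (cis t - z))" for t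
    have P0: "P t \<ge> 0" for t
      unfolding P_def Poisson_kernel_eq using z by (simp add: power_le_one)
    have P_cont: "continuous_on S P" for S
      unfolding P_def by (rule continuous_on_Poisson_kernel[OF z])
    have P_meas: "P \<in> borel_measurable circle_meas"
      using integrable_circle_meas_continuous[OF P_cont] by auto
    have "bounded (P ` {0..2*pi})"
      by (intro compact_imp_bounded compact_continuous_image P_cont) auto
    then obtain B where B: "\<And>t. t \<in> {0..2*pi} \<Longrightarrow> \<bar>P t\<bar> \<le> B"
      unfolding bounded_iff by (metis imageI real_norm_def)
    have DP: "integrable circle_meas (\<lambda>t. D t * P t)"
    proof (rule Bochner_Integration.integrable_bound)
      show "integrable circle_meas (\<lambda>t. B * D t)" using D by simp
      show "(\<lambda>t. D t * P t) \<in> borel_measurable circle_meas" using D P_meas by auto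
      show "AE t in circle_meas. norm (D t * P t) \<le> norm (B * D t)"
      proof (rule AE_I2)
        fix t assume "t \<in> space circle_meas"
        then have "\<bar>P t\<bar> \<le> \<bar>B\<bar>" using B[of t] by (auto simp: circle_meas_def)
        then show "norm (D t * P t) \<le> norm (B * D t)" 
          by (simp add: abs_mult mult_right_mono mult.commute[of "\<bar>D t\<bar>"])
      qed
    qed
    have uP: "integrable circle_meas (\<lambda>t. Re (h (of_real (r n) * cis t)) * P t)" for n
      using r_norm by (intro integrable_circle_meas_continuous continuous_intros P_cont
        continuous_on_compose2[OF holomorphic_on_imp_continuous_on[OF h(1)]]) auto
    have vn: "integrable circle_meas (\<lambda>t. (D t - Re (h (of_real (r n) * cis t))) * P t)" for n
      using Bochner_Integration.integrable_diff[OF DP uP[of n]] by (simp add: algebra_simps)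
    have vn0: "AE t in circle_meas. 0 \<le> (D t - Re (h (of_real (r n) * cis t))) * P t" for n
      using dom
    proof eventually_elim
      case (elim t)
      with r[of n] have "Re (h (of_real (r n) * cis t)) \<le> D t"
        by (simp flip: ln_f add: r_norm)
      with P0[of t] show ?case by simp
    qed
    have w: "(\<lambda>t. (D t - ln (norm (g t))) * P t) \<in> borel_measurable circle_meas"
      using D P_meas g by auto
    have wlim: "AE t in circle_meas. (\<lambda>n. (D t - Re (h (of_real (r n) * cis t))) * P t)
        \<longlonglongrightarrow> (D t - ln (norm (g t))) * P t"
      using u_lim by eventually_elim (intro tendsto_intros)
    have int_vn: "(\<integral>t. (D t - Re (h (of_real (r n) * cis t))) * P t \<partial>circle_meas)
        = (\<integral>t. D t * P t \<partial>circle_meas) - 2 * pi * Re (h (of_real (r n) * z))" for n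
      using Poisson_formula[OF hr[of n] z, folded P_def] Bochner_Integration.integral_diff[OF DP uP[of n]]
      by (simp add: algebra_simps)
    have "isCont h z"
      using holomorphic_on_imp_continuous_on[OF h(1)] z by (simp add: continuous_on_eq_continuous_at)
    moreover have "(\<lambda>n. of_real (r n) * z) \<longlonglongrightarrow> z"
      using tendsto_mult[OF tendsto_of_real[OF r_lim] tendsto_const[of z]] by simp
    ultimately have "(\<lambda>n. h (of_real (r n) * z)) \<longlonglongrightarrow> h z"
      by (rule isCont_tendsto_compose)
    then have L: "(\<lambda>n. \<integral>t. (D t - Re (h (of_real (r n) * cis t))) * P t \<partial>circle_meas)
        \<longlonglongrightarrow> (\<integral>t. D t * P t \<partial>circle_meas) - 2 * pi * Re (h z)"
      unfolding int_vn by (intro tendsto_intros)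
    show ?thesis
      using Fatou_real[OF vn vn0 w wlim L] DP unfolding P_def ln_f[OF z] by blast
  qed
  \<comment> \<open>At \<open>z = 0\<close> the Poisson kernel is 1.\<close>
  have "integrable circle_meas (\<lambda>t. D t - ln (norm (g t)))"
    using main[of 0] by (simp add: cis_neq_zero)
  from Bochner_Integration.integrable_diff[OF D this]
  show "integrable circle_meas (\<lambda>t. ln (norm (g t)))" by simp
  assume "z \<in> ball 0 1"
  then have z: "norm z < 1" by simp
  let ?P = "\<lambda>t. Re ((cis t + z) / (cis t - z))"
  from main[OF z] have "(\<integral>t. D t * ?P t - (D t - ln (norm (g t))) * ?P t \<partial>circle_meas) \<ge> 2 * pi * ln (norm (f z))"
    by (subst Bochner_Integration.integral_diff) auto
  then have "(\<integral>t. ln (norm (g t)) * ?P t \<partial>circle_meas) \<ge> 2 * pi * ln (norm (f z))"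
    by (simp only: left_diff_distrib) simp
  then show "ln (norm (f z)) \<le> (1 / (2*pi)) * (\<integral>t. ln (norm (g t)) * ?P t \<partial>circle_meas)"
    by (simp add: field_simps)
qed

section \<open>Transfer to the disc\<close>

text \<open>At the pole, division by zero gives \<open>cayley 1 = 0\<close>, so that
  \<open>cayley_cis_real\<close> holds for every angle.\<close>

definition cayley :: "complex \<Rightarrow> complex" where
  "cayley z = \<i> * ((1 + z) / (1 - z))"

text \<open>The right-hand side is the Poisson kernel at the boundary point
  \<open>cis 0 = 1\<close>.\<close>

lemma Im_cayley: "Im (cayley z) = (1 - (norm z)\<^sup>2) / (norm (1 - z))\<^sup>2"
  using Poisson_kernel_eq[of 0 z] by (simp add: cayley_def del: times_divide_eq_right)

lemma cayley_cis_real: "cayley (cis t) \<in> \<real>"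
  by (simp add: complex_is_Real_iff Im_cayley)

lemma Im_cayley_pos:
  assumes "norm z < 1"
  shows "Im (cayley z) > 0"
proof -
  have "z \<noteq> 1" using assms by auto
  moreover have "(norm z)\<^sup>2 < 1" using assms by (simp add: power_less_one_iff abs_square_less_1)
  ultimately show ?thesis unfolding Im_cayley by simp
qed

lemma holomorphic_cayley: "1 \<notin> S \<Longrightarrow> cayley holomorphic_on S"
  unfolding cayley_def[abs_def] by (intro holomorphic_intros) auto

lemma cayley_inject:
  assumes "a \<noteq> 1" "b \<noteq> 1" "cayley a = cayley b"
  shows "a = b"
proof -
  have "(1 + a) * (1 - b) = (1 + b) * (1 - a)"
    using assms by (simp add: cayley_def frac_eq_eq)
  then have "2 * a = 2 * b" by (simp add: algebra_simps)
  then show ?thesis by simp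
qed

lemma norm_cayley_le:
  assumes "norm z \<le> 1"
  shows "norm (cayley z) \<le> 2 / norm (1 - z)"
  unfolding cayley_def using assms norm_triangle_ineq[of 1 z]
  by (simp add: norm_mult norm_divide divide_right_mono)

text \<open>With \<open>\<zeta> = cis t\<close>,
  \<open>|r \<zeta> - \<zeta>| = 1 - r \<le> |1 - r \<zeta>|\<close>, hence
  \<open>|1 - \<zeta>| \<le> 2 * |1 - r \<zeta>|\<close>. Independence of \<open>r\<close> gives one
  majorant for a whole radius.\<close>

lemma norm_cayley_radial_le:
  assumes "0 \<le> r" "r < 1" "cis t \<noteq> 1"
  shows "norm (cayley (of_real r * cis t)) \<le> 4 / norm (1 - cis t)"
proof -
  let ?z = "of_real r * cis t"
  have "norm (?z - cis t) = norm (of_real (r - 1) * cis t)" by (simp add: algebra_simps)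
  also have "\<dots> = 1 - r" using assms by (simp only: norm_mult norm_cis norm_of_real) simp
  also have "\<dots> \<le> norm (1 - ?z)"
    using norm_triangle_ineq2[of 1 ?z] assms by (simp add: norm_mult)
  finally have "norm (1 - cis t) \<le> 2 * norm (1 - ?z)"
    using norm_triangle_ineq[of "1 - ?z" "?z - cis t"] by simp
  moreover have "norm (1 - cis t) > 0" using assms by simp
  ultimately have "4 / (2 * norm (1 - ?z)) \<le> 4 / norm (1 - cis t)"
    by (intro frac_le) auto
  moreover have "norm (cayley ?z) \<le> 2 / norm (1 - ?z)"
    using assms by (intro norm_cayley_le) (simp add: norm_mult)
  ultimately show ?thesis by simp
qed

section \<open>Chords, null sets and integrability on the circle\<close>

lemma Jordan_sin_inequality:
  assumes "0 \<le> x" "x \<le> pi / 2"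
  shows "2 * x / pi \<le> sin x"
proof -
  \<comment> \<open>Concavity of the sine puts its graph above the chord from 0 to
    \<open>pi / 2\<close>.\<close>
  have "convex_on {0..pi/2} (\<lambda>x. - sin x)"
    by (rule f''_ge0_imp_convex[where f' = "\<lambda>x. - cos x" and f'' = sin])
       (auto intro!: derivative_eq_intros sin_ge_zero)
  from convex_onD[OF this, of "2 * x / pi" 0 "pi / 2"] assms show ?thesis
    by (simp add: field_simps)
qed

lemma norm_1_minus_cis: "norm (1 - cis t) = 2 * \<bar>sin (t / 2)\<bar>"
  using dist_exp_i_1[of t] by (simp add: cis_conv_exp norm_minus_commute)

text \<open>\<open>min t (2 * pi - t)\<close> is the length of the shorter arc from 1 to
  \<open>cis t\<close>; Jordan's inequality applies to half of it.\<close>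

lemma chord_ge:
  assumes "0 \<le> t" "t \<le> 2 * pi"
  shows "norm (1 - cis t) \<ge> 2 / pi * min t (2 * pi - t)"
proof (cases "t \<le> pi")
  case True
  then have "2 * (t / 2) / pi \<le> sin (t / 2)" using assms by (intro Jordan_sin_inequality) auto
  then show ?thesis unfolding norm_1_minus_cis using True by (simp add: min_def)
next
  case False
  have "2 * ((2 * pi - t) / 2) / pi \<le> sin ((2 * pi - t) / 2)"
    using False assms by (intro Jordan_sin_inequality) auto
  also have "sin ((2 * pi - t) / 2) = sin (t / 2)"
    using sin_pi_minus[of "t / 2"] by (simp add: diff_divide_distrib)
  finally show ?thesis unfolding norm_1_minus_cis using False by (simp add: min_def)
qed

lemma AE_circle_meas_countable:
  assumes "countable A"
  shows "AE t in circle_meas. t \<notin> A"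
proof -
  have "AE t in lborel. t \<notin> A"
    using countable_imp_null_set_lborel[OF assms] by (rule AE_not_in)
  then have "AE t in lebesgue. t \<notin> A" by (rule AE_completion)
  then show ?thesis unfolding circle_meas_def by (subst AE_restrict_space_iff) auto
qed

lemma AE_circle_meas_interior: "AE t in circle_meas. 0 < t \<and> t < 2 * pi"
proof -
  have "AE t in circle_meas. t \<notin> {0, 2 * pi}" by (rule AE_circle_meas_countable) auto
  moreover have "AE t in circle_meas. t \<in> space circle_meas" by (rule AE_space)
  ultimately show ?thesis by eventually_elim (auto simp: circle_meas_def)
qed

lemma cis_neq_1:
  assumes "0 < t" "t < 2 * pi"
  shows "cis t \<noteq> 1"
proof -
  have "sin (t / 2) > 0" using assms by (intro sin_gt_zero) auto
  then have "norm (1 - cis t) \<noteq> 0" unfolding norm_1_minus_cis by simp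
  then show ?thesis by auto
qed

text \<open>Injectivity pulls the countable zero set of \<open>Q\<close> back to a countable, hence
  null, set of angles.\<close>

lemma inj_on_cayley_cis: "inj_on (\<lambda>t. cayley (cis t)) {0<..<2*pi}"
proof (rule inj_onI)
  fix s t assume st: "s \<in> {0<..<2*pi}" "t \<in> {0<..<2*pi}" "cayley (cis s) = cayley (cis t)"
  then have "cis s \<noteq> 1" "cis t \<noteq> 1" by (simp_all add: cis_neq_1)
  then have "cis s = cis t" using st(3) by (rule cayley_inject)
  moreover have "Arg2pi (cis s) = s" "Arg2pi (cis t) = t"
    using st by (auto intro!: Arg2pi_unique[of 1] simp: cis_conv_exp)
  ultimately show "s = t" by metis
qed

text \<open>By the chord estimate the singularity at each end of the interval is of order
  \<open>-p\<close> in the distance, which is integrable for \<open>p < 1\<close>.\<close>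

lemma integrable_circle_meas_powr:
  assumes "0 < p" "p < 1"
  shows "integrable circle_meas (\<lambda>t. (4 / norm (1 - cis t)) powr p)"
proof -
  have int: "integrable circle_meas u" if "u integrable_on {0..2*pi}" "\<And>t. t \<in> {0..2*pi} \<Longrightarrow> 0 \<le> u t"
    for u :: "real \<Rightarrow> real"
    using nonnegative_absolutely_integrable_1[OF that]
    by (simp add: circle_meas_def set_integrable_def integrable_restrict_space)
  have "((\<lambda>t. t powr (-p)) has_integral ((2*pi) powr (-p + 1) / (-p + 1))) {0..2*pi}"
    using assms by (intro has_integral_powr_from_0) auto
  note i1 = this
  \<comment> \<open>The reflection \<open>t \<mapsto> 2 * pi - t\<close> carries the integral at the
    left end over to the right end.\<close>
  have img: "(\<lambda>x. - x + 2 * pi) ` {0..2*pi} = {0..2*pi}"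
    using image_affinity_atLeastAtMost[of "-1" "2 * pi" 0 "2 * pi"] by simp
  have "((\<lambda>t. (2 * pi - t) powr (-p)) has_integral ((2*pi) powr (-p + 1) / (-p + 1))) {0..2*pi}"
    using has_integral_affinity[of "\<lambda>t. t powr (-p)" "(2*pi) powr (-p + 1) / (-p + 1)" 0 "2 * pi" "-1" "2 * pi"] i1
    by (simp add: img)
  with i1 have "integrable circle_meas (\<lambda>t. t powr (-p))" "integrable circle_meas (\<lambda>t. (2 * pi - t) powr (-p))"
    by (auto intro!: int)
  then have bound: "integrable circle_meas (\<lambda>t. (2 * pi) powr p * (t powr (-p) + (2 * pi - t) powr (-p)))"
    by simp
  show ?thesis
  proof (rule Bochner_Integration.integrable_bound[OF bound])
    have [measurable]: "cis \<in> borel_measurable borel"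
      by (intro borel_measurable_continuous_onI continuous_intros)
    have "(\<lambda>t. (4 / norm (1 - cis t)) powr p) \<in> borel_measurable borel"
      by (intro powr_real_measurable) measurable
    then show "(\<lambda>t. (4 / norm (1 - cis t)) powr p) \<in> borel_measurable circle_meas"
      unfolding circle_meas_def by (intro measurable_restrict_space1 measurable_completion) simp
    show "AE t in circle_meas. norm ((4 / norm (1 - cis t)) powr p)
        \<le> norm ((2 * pi) powr p * (t powr (-p) + (2 * pi - t) powr (-p)))"
      using AE_circle_meas_interior
    proof eventually_elim
      case (elim t)
      define m where "m = min t (2 * pi - t)"
      have m: "m > 0" using elim by (simp add: m_def)
      have "2 / pi * m \<le> norm (1 - cis t)" using chord_ge[of t] elim by (simp add: m_def)
      then have "4 / norm (1 - cis t) \<le> 4 / (2 / pi * m)" using m by (intro frac_le) auto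
      then have "(4 / norm (1 - cis t)) powr p \<le> (2 * pi / m) powr p"
        using assms by (intro powr_mono2) auto
      also have "\<dots> = (2 * pi) powr p * m powr (-p)" using m by (simp add: powr_divide powr_minus_divide)
      also have "m powr (-p) \<le> t powr (-p) + (2 * pi - t) powr (-p)"
        by (simp add: m_def min_def)
      finally show ?case by (simp add: mult_left_mono)
    qed
  qed
qed

text \<open>Where the modulus is at least \<open>s\<close>, the real number
  \<open>cayley (cis t)\<close> exceeds \<open>R\<close> in modulus, so \<open>t\<close> is within
  \<open>pi / R\<close> of 0 or \<open>2 * pi\<close>. The two arcs have total length at most
  \<open>2 * pi / R\<close>.\<close>

lemma distrib_fun_cayley_le:
  assumes "R > 0" "\<And>x. \<bar>x\<bar> \<le> R \<Longrightarrow> norm (Q (of_real x)) < s"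
  shows "distrib_fun (\<lambda>t. \<i> * Q (cayley (cis t))) s \<le> 1 / R"
proof -
  interpret finite_measure circle_meas
    unfolding circle_meas_def by (rule finite_measure_lebesgue_on) auto
  have "{t \<in> {0..2*pi}. s \<le> norm (\<i> * Q (cayley (cis t)))}
      \<subseteq> {0..2*pi} \<inter> {0..pi/R} \<union> {0..2*pi} \<inter> {2*pi - pi/R..2*pi}"
  proof
    fix t assume "t \<in> {t \<in> {0..2*pi}. s \<le> norm (\<i> * Q (cayley (cis t)))}"
    then have t: "0 \<le> t" "t \<le> 2 * pi" "s \<le> norm (Q (cayley (cis t)))" by (auto simp: norm_mult)
    obtain x where x: "cayley (cis t) = of_real x" using cayley_cis_real[of t] by (auto elim: Reals_cases)
    with t assms(2)[of x] have "R < norm (cayley (cis t))" by force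
    also have "\<dots> \<le> 2 / norm (1 - cis t)" by (intro norm_cayley_le) simp
    finally have R: "R < 2 / norm (1 - cis t)" .
    then have "norm (1 - cis t) > 0" using assms(1) by (cases "norm (1 - cis t) = 0") auto
    then have "norm (1 - cis t) * R < 2" using R by (simp add: field_simps)
    moreover have "2 / pi * min t (2 * pi - t) * R \<le> norm (1 - cis t) * R"
      using chord_ge[OF t(1,2)] assms(1) by (intro mult_right_mono) auto
    ultimately have "2 / pi * min t (2 * pi - t) * R < 2" by linarith
    then have "min t (2 * pi - t) < pi / R" using assms(1) by (simp add: field_simps)
    with t show "t \<in> {0..2*pi} \<inter> {0..pi/R} \<union> {0..2*pi} \<inter> {2*pi - pi/R..2*pi}"
      by (auto simp: min_def split: if_splits)
  qed
  moreover have sets: "{0..2*pi} \<inter> {a..b} \<in> sets circle_meas" for a b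
    unfolding circle_meas_def sets_restrict_space by (rule imageI) simp
  ultimately have "measure circle_meas {t \<in> {0..2*pi}. s \<le> norm (\<i> * Q (cayley (cis t)))}
      \<le> measure circle_meas ({0..2*pi} \<inter> {0..pi/R} \<union> {0..2*pi} \<inter> {2*pi - pi/R..2*pi})"
    by (intro finite_measure_mono sets.Un)
  also have "\<dots> \<le> measure circle_meas ({0..2*pi} \<inter> {0..pi/R})
      + measure circle_meas ({0..2*pi} \<inter> {2*pi - pi/R..2*pi})"
    by (intro measure_Un_le sets)
  also have "\<dots> = measure lebesgue ({0..2*pi} \<inter> {0..pi/R}) + measure lebesgue ({0..2*pi} \<inter> {2*pi - pi/R..2*pi})"
    unfolding circle_meas_def by (simp add: measure_restrict_space)
  also have "\<dots> \<le> measure lebesgue {0..pi/R} + measure lebesgue {2*pi - pi/R..2*pi}"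
    by (intro add_mono measure_mono_fmeasurable) auto
  also have "\<dots> = 2 * pi * (1 / R)" using assms(1) by simp
  finally show ?thesis
    unfolding distrib_fun_def by (simp add: field_simps)
qed

lemma Liminf_at_top_eq_0:
  fixes \<phi> :: "real \<Rightarrow> real"
  assumes "\<forall>\<^sub>F s in at_top. 0 \<le> \<phi> s" and "\<And>T e. 0 < e \<Longrightarrow> \<exists>s\<ge>T. \<phi> s \<le> e"
  shows "Liminf at_top (\<lambda>s. ereal (\<phi> s)) = 0"
proof (rule antisym)
  show "0 \<le> Liminf at_top (\<lambda>s. ereal (\<phi> s))"
    by (rule Liminf_bounded) (use assms(1) in simp)
  show "Liminf at_top (\<lambda>s. ereal (\<phi> s)) \<le> 0"
  proof (rule ccontr)
    assume "\<not> Liminf at_top (\<lambda>s. ereal (\<phi> s)) \<le> 0"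
    then obtain e where e: "0 < ereal e" "ereal e < Liminf at_top (\<lambda>s. ereal (\<phi> s))"
      using ereal_dense2[of 0] by (auto simp: not_le)
    from less_LiminfD[OF e(2)] obtain T where "\<And>s. s \<ge> T \<Longrightarrow> e < \<phi> s"
      unfolding eventually_at_top_linorder by auto
    with assms(2)[of e T] e(1) show False by force
  qed
qed

section \<open>The function on the disc and its boundary values\<close>

theorem mainTheorem1:
  shows "\<exists>(f::complex \<Rightarrow> complex) (g::real \<Rightarrow> complex).
    f holomorphic_on ball 0 1 \<and>
    \<not> (\<exists>c. \<forall>z\<in>ball 0 1. f z = c) \<and>
    g \<in> borel_measurable circle_meas \<and>
    (AE \<theta> in circle_meas. nontangential_limit f (cis \<theta>) (g \<theta>)) \<and>
    \<comment> \<open>(1) Smirnov class\<close>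
    (AE \<theta> in circle_meas. g \<theta> \<noteq> 0) \<and>
    integrable circle_meas (\<lambda>\<theta>. ln (norm (g \<theta>))) \<and>
    (\<forall>z\<in>ball 0 1. f z \<noteq> 0 \<longrightarrow>
       ln (norm (f z)) \<le> (1 / (2*pi)) *
         (\<integral>\<theta>. ln (norm (g \<theta>)) * Re ((cis \<theta> + z) / (cis \<theta> - z)) \<partial>circle_meas)) \<and>
    \<comment> \<open>(2)\<close>
    Liminf at_top (\<lambda>t::real. ereal (t * distrib_fun g t)) = 0 \<and>
    \<comment> \<open>(3)\<close>
    (AE \<theta> in circle_meas. Re (g \<theta>) = 0)"
proof -
  \<comment> \<open>\<open>\<rho> t\<close> bounds \<open>|cayley|\<close> on the radius towards
    \<open>cis t\<close>. Its moments \<open>K\<close> enter the construction as weights so that the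
    majorant \<open>D\<close> becomes integrable.\<close>
  define \<rho> where "\<rho> t = 4 / norm (1 - cis t)" for t
  define K where "K q = (\<integral>t. \<rho> t powr q \<partial>circle_meas)" for q
  have K0: "0 \<le> K q" for q unfolding K_def by (intro integral_nonneg_AE) auto
  obtain Q c p where hol: "Q holomorphic_on UNIV" and real: "\<And>x. Q (of_real x) \<in> \<real>"
    and nz: "\<And>w. Im w > 0 \<Longrightarrow> Q w \<noteq> 0" and nonconst: "\<not> Q constant_on {w. Im w > 0}"
    and cp: "\<And>k. 0 < p k \<and> p k < 1 \<and> 0 \<le> c k"
    and sum_c: "summable c" and sum_cK: "summable (\<lambda>k. c k * K (p k))"
    and Q_le: "\<And>w. norm (Q w) \<le> exp (\<Sum>k. c k * norm w powr p k)"
    and levels: "\<And>\<epsilon>. \<epsilon> > 0 \<Longrightarrow>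
      \<exists>t R. 1 / \<epsilon> \<le> t \<and> t \<le> \<epsilon> * R \<and> (\<forall>x. \<bar>x\<bar> \<le> R \<longrightarrow> norm (Q (of_real x)) \<le> t)"
    by (rule slowly_growing_entire_function_exists[OF K0]) (rule that, assumption+)
  define f where "f z = \<i> * Q (cayley z)" for z
  define g where "g t = \<i> * Q (cayley (cis t))" for t
  define D where "D t = (\<Sum>k. c k * \<rho> t powr p k)" for t
  have Q_cont: "continuous_on S Q" for S
    using hol holomorphic_on_imp_continuous_on holomorphic_on_subset by blast
  have f_hol: "f holomorphic_on ball 0 1"
    unfolding f_def
    by (intro holomorphic_intros
          holomorphic_on_compose_gen[of cayley _ Q, unfolded o_def, OF _ hol] holomorphic_cayley) auto
  have f_nz: "f z \<noteq> 0" if "z \<in> ball 0 1" for z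
    using nz[OF Im_cayley_pos[of z]] that by (simp add: f_def)
  have f_nonconst: "\<not> (\<exists>a. \<forall>z\<in>ball 0 1. f z = a)"
  proof
    assume "\<exists>a. \<forall>z\<in>ball 0 1. f z = a"
    then obtain a where a: "\<And>z. norm z < 1 \<Longrightarrow> \<i> * Q (cayley z) = a" by (auto simp: f_def)
    have "Q w = - \<i> * a" if "Im w > 0" for w
    proof -
      \<comment> \<open>The inverse Cayley map, which shows that \<open>cayley\<close> takes every
        value in the upper half-plane.\<close>
      define z where "z = (w - \<i>) / (w + \<i>)"
      have w: "w + \<i> \<noteq> 0" using that by (auto simp: complex_eq_iff)
      have "1 + z = 2 * w / (w + \<i>)" "1 - z = 2 * \<i> / (w + \<i>)"
        using w by (simp_all add: z_def field_simps)
      then have "cayley z = w" using w by (simp add: cayley_def)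
      moreover have "(norm (w - \<i>))\<^sup>2 < (norm (w + \<i>))\<^sup>2"
        unfolding cmod_power2 using that by (simp add: power2_eq_square algebra_simps)
      then have "norm (w - \<i>) < norm (w + \<i>)" by (rule power_less_imp_less_base) simp
      then have "norm z < 1" using w by (simp add: z_def norm_divide)
      ultimately have "\<i> * Q w = a" using a by metis
      then show ?thesis by auto
    qed
    with nonconst show False unfolding constant_on_def by blast
  qed
  have g_meas: "g \<in> borel_measurable circle_meas"
  proof -
    have [measurable]: "cis \<in> borel_measurable borel"
      by (intro borel_measurable_continuous_onI continuous_intros)
    have [measurable]: "Q \<in> borel_measurable borel"
      by (intro borel_measurable_continuous_onI Q_cont)
    have "g \<in> borel_measurable borel" unfolding g_def[abs_def] cayley_def by measurable
    then show ?thesis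
      unfolding circle_meas_def by (intro measurable_restrict_space1 measurable_completion) simp
  qed
  have lim: "AE t in circle_meas. nontangential_limit f (cis t) (g t)"
    using AE_circle_meas_interior
  proof eventually_elim
    case (elim t)
    then have "cis t \<noteq> 1" by (simp add: cis_neq_1)
    \<comment> \<open>Away from the point 1 the formula for \<open>f\<close> is continuous in a full
      neighbourhood, so the limit exists within every Stolz angle.\<close>
    then have "isCont cayley (cis t)" unfolding cayley_def by (intro continuous_intros) auto
    moreover have "isCont Q (cayley (cis t))"
      using Q_cont[of UNIV] by (simp add: continuous_on_eq_continuous_at)
    ultimately have "isCont f (cis t)"
      unfolding f_def by (intro continuous_intros isCont_o2[of _ cayley Q]) 
    then show ?case
      unfolding nontangential_limit_def g_def f_def isCont_def
      by (auto intro: tendsto_within_subset)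
  qed
  have g_nz: "AE t in circle_meas. g t \<noteq> 0"
  proof -
    \<comment> \<open>The zeros of a non-constant entire function are countable.\<close>
    have "\<not> Q constant_on UNIV" using nonconst constant_on_subset by blast
    then have "countable {w \<in> UNIV. Q w = 0}"
      using hol by (intro holomorphic_countable_zeros) auto
    then have "countable ((\<lambda>t. cayley (cis t)) ` {t \<in> {0<..<2*pi}. Q (cayley (cis t)) = 0})"
      by (rule countable_subset[rotated]) auto
    then have "countable {t \<in> {0<..<2*pi}. Q (cayley (cis t)) = 0}"
      by (rule countable_image_inj_on) (rule inj_on_subset[OF inj_on_cayley_cis], auto)
    from AE_circle_meas_countable[OF this] AE_circle_meas_interior show ?thesis
      by eventually_elim (auto simp: g_def)
  qed
  have summ: "summable (\<lambda>k. c k * x powr p k)" if "0 \<le> x" for x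
    using sum_c cp that by (intro summable_mult_powr) auto
  have \<rho>0: "0 \<le> \<rho> t" for t by (simp add: \<rho>_def)
  have D_int: "integrable circle_meas D"
    unfolding D_def
  proof (rule integrable_suminf)
    show "integrable circle_meas (\<lambda>t. c k * \<rho> t powr p k)" for k
      using integrable_circle_meas_powr[of "p k"] cp[of k] by (simp add: \<rho>_def)
    have norm_eq: "norm (c k * \<rho> t powr p k) = c k * \<rho> t powr p k" for k t
      using cp[of k] by (simp add: abs_mult)
    show "AE t in circle_meas. summable (\<lambda>k. norm (c k * \<rho> t powr p k))"
      unfolding norm_eq using summ[OF \<rho>0] by simp
    show "summable (\<lambda>k. \<integral>t. norm (c k * \<rho> t powr p k) \<partial>circle_meas)"
      unfolding norm_eq using sum_cK by (simp add: K_def)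
  qed
  have dom: "AE t in circle_meas. \<forall>r. 0 \<le> r \<and> r < 1 \<longrightarrow> ln (norm (f (of_real r * cis t))) \<le> D t"
    using AE_circle_meas_interior
  proof eventually_elim
    case (elim t)
    show ?case
    proof (intro allI impI)
      fix r :: real assume r: "0 \<le> r \<and> r < 1"
      define w where "w = cayley (of_real r * cis t)"
      have "norm w \<le> \<rho> t"
        unfolding w_def \<rho>_def using r elim by (intro norm_cayley_radial_le cis_neq_1) auto
      then have "(\<Sum>k. c k * norm w powr p k) \<le> D t"
        unfolding D_def using cp
        by (intro suminf_le summ \<rho>0 mult_left_mono powr_mono2) (auto simp: less_imp_le)
      moreover have "norm (f (of_real r * cis t)) = norm (Q w)"
        by (simp add: f_def w_def norm_mult)
      ultimately have "norm (f (of_real r * cis t)) \<le> exp (D t)"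
        using Q_le[of w] by (simp add: order_trans)
      moreover have "f (of_real r * cis t) \<noteq> 0"
        using r by (intro f_nz) (simp add: norm_mult)
      ultimately show "ln (norm (f (of_real r * cis t))) \<le> D t"
        by (metis exp_gt_zero ln_exp ln_mono zero_less_norm_iff)
    qed
  qed
  note Smirnov = Smirnov_if_dominated[OF f_hol f_nz g_meas lim g_nz D_int dom]
  have liminf: "Liminf at_top (\<lambda>t. ereal (t * distrib_fun g t)) = 0"
  proof (rule Liminf_at_top_eq_0)
    show "\<forall>\<^sub>F s in at_top. 0 \<le> s * distrib_fun g s"
      using eventually_ge_at_top[of 0] by eventually_elim (simp add: distrib_fun_def)
    fix T e :: real assume e: "0 < e"
    \<comment> \<open>The two terms of the minimum give \<open>2 * \<epsilon> \<le> e\<close> and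
      \<open>T \<le> 1 / \<epsilon> \<le> t\<close>.\<close>
    define \<epsilon> where "\<epsilon> = min (e / 2) (1 / max T 1)"
    have \<epsilon>: "\<epsilon> > 0" "\<epsilon> \<le> e / 2" "\<epsilon> \<le> 1 / max T 1" using e by (auto simp: \<epsilon>_def)
    from levels[OF \<epsilon>(1)] obtain t R where tR: "1 / \<epsilon> \<le> t" "t \<le> \<epsilon> * R"
      "\<And>x. \<bar>x\<bar> \<le> R \<Longrightarrow> norm (Q (of_real x)) \<le> t" by blast
    have t: "t > 0" using tR(1) \<epsilon>(1) by (smt (verit) divide_pos_pos)
    have R: "R > 0" using tR(2) t \<epsilon>(1) by (smt (verit) mult_nonneg_nonpos)
    have "\<epsilon> * max T 1 \<le> 1" using \<epsilon>(3) by (simp add: pos_le_divide_eq)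
    then have "max T 1 \<le> 1 / \<epsilon>" using \<epsilon>(1) by (simp only: pos_le_divide_eq mult.commute)
    then have "T \<le> 2 * t" using tR(1) t by linarith
    \<comment> \<open>Testing at \<open>2 * t\<close> rather than \<open>t\<close> turns
      \<open>|Q| \<le> t\<close> into the strict inequality that
      \<open>distrib_fun_cayley_le\<close> asks for.\<close>
    moreover have "2 * t * distrib_fun g (2 * t) \<le> e"
    proof -
      have "norm (Q (of_real x)) < 2 * t" if "\<bar>x\<bar> \<le> R" for x using tR(3)[OF that] t by linarith
      then have "distrib_fun g (2 * t) \<le> 1 / R"
        unfolding g_def[abs_def] by (intro distrib_fun_cayley_le R)
      then have "2 * t * distrib_fun g (2 * t) \<le> 2 * t * (1 / R)" using t by (intro mult_left_mono) auto
      also have "\<dots> \<le> 2 * \<epsilon>" using tR(2) R by (simp add: field_simps)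
      finally show ?thesis using \<epsilon>(2) by simp
    qed
    ultimately show "\<exists>s\<ge>T. s * distrib_fun g s \<le> e" by blast
  qed
  have Re_g: "Re (g t) = 0" for t
  proof -
    obtain x where "cayley (cis t) = of_real x" using cayley_cis_real[of t] by (auto elim: Reals_cases)
    with real[of x] show ?thesis by (simp add: g_def complex_is_Real_iff)
  qed
  show ?thesis
    using f_hol f_nonconst g_meas lim g_nz Smirnov liminf Re_g
    by (intro exI[of _ f] exI[of _ g] conjI ballI impI) auto
qed

end
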